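(* There is a universal constant $C>0$ (the paper's $O(1)$) such that the following holds. Let $m:\mathbb{R}^p\to\mathbb{R}^d$ be a monomial feature map (each coordinate of $m(x)$ is a monomial in the coordinates of $x$), let $B_Q>0$, and let $$\mathcal{V}=\left\{V_Q(x)=m(x)^{\mathsf T}Q\,m(x):Q\in\mathbb{R}^{d\times d},\ Q=Q^{\mathsf T}\succeq0,\ \|Q\|_F\le B_Q\right\}.$$ Assume there is a compact set $S\subseteq\mathbb{R}^p$ such that $\varphi_t(\xi)\in S$ for all $\xi\in X$, $t\in T$. Let $\gamma>0$, $\delta\in(0,1)$, and let $\xi_1,\dots,\xi_n$ be i.i.d. samples from $\mathcal{D}$. If the problem of finding $V\in\mathcal{V}$ such that $$h\left(\varphi_t(\xi_i),\dot\varphi_t(\xi_i),V(\varphi_t(\xi_i)),\tfrac{\partial V}{\partial x}(\varphi_t(\xi_i))\right)\le-\gamma,\qquad i=1,\dots,n,\ t\in T,$$ is feasible, then any solution $\hat V_n\in\mathcal{V}$ satisfies, with probability at least $1-\delta$ over $\xi_1,\dots,\xi_n$, $$\mathsf{err}(\hat V_n)\le C\left(B_Q^2(B_m^2+B_{Dm}B_m)^2L_h^2\,\frac{d\log^2 d\,\log^3 n}{\gamma^2 n}+\frac{\log(\log(B_h/\gamma)/\delta)}{n}\right),$$ where $B_m:=\sup_{x\in S}\|m(x)\|$ and $B_{Dm}:=\sup_{x\in S}\left\|\frac{\partial m}{\partial x}(x)\right\|$.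
   Context: Setting. The dynamical system is $\dot x=f(x)$ with $f:\mathbb{R}^p\to\mathbb{R}^p$ continuous. $X\subseteq\mathbb{R}^p$ is compact, and $T\subseteq\mathbb{R}_+$ is the maximal interval starting at zero on which a unique solution $\varphi_t(\xi)$ with initial condition $\varphi_0(\xi)=\xi$ exists for all $\xi\in X$, $t\in T$. $\mathcal{D}$ is a probability distribution on $X$. $\dot\varphi_t(\xi)$ is the time derivative of $t\mapsto\varphi_t(\xi)$. $h:\mathbb{R}^p\times\mathbb{R}^p\times\mathbb{R}\times\mathbb{R}^{p}\to\mathbb{R}$ is a fixed known continuous function (certificates are scalar-valued, $V:\mathbb{R}^p\to\mathbb{R}$, continuously differentiable). Generalization error: for $V\in\mathcal{V}$, $$\mathsf{err}(V):=\mathbb{P}_{\xi\sim\mathcal{D}}\left\{\max_{t\in T}h\left(\varphi_t(\xi),\dot\varphi_t(\xi),V(\varphi_t(\xi)),\tfrac{\partial V}{\partial x}(\varphi_t(\xi))\right)>0\right\};$$ the probability is over a fresh $\xi$, with $V$ fixed. Constants: $B_V,B_{\nabla V}$ are finite constants with $\sup_{V\in\mathcal{V}}\sup_{x\in S}|V(x)|\le B_V$ and $\sup_{V\in\mathcal{V}}\sup_{x\in S}\|\frac{\partial V}{\partial x}(x)\|\le B_{\nabla V}$ (these exist for the class in the claim). $B_h$ is a (finite) upper bound on $|h(x,f(x),v,w)|$ over $x\in S$, $|v|\le B_V$, $\|w\|\le B_{\nabla V}$; $L_h$ is a (finite) upper bound, valid for all $x\in S$, on the Lipschitz constant of $(v,w)\mapsto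 h(x,f(x),v,w)$ over $|v|\le B_V$, $\|w\|\le B_{\nabla V}$. $\|\cdot\|$ is the Euclidean norm for vectors and the operator norm for matrices; $\|\cdot\|_F$ is the Frobenius norm.
   Formalization: In the bound, log d, log n and log(B_h/γ) are each replaced by max(1, log ·), because the bound with plain logarithms fails for d = 1, for n = 1, or for B_h close to γ (e.g. h ≡ −γ, L_h = 0 makes the right side negative). *)

theory Defs
  imports "HOL-Probability.Probability"
begin

text \<open>
  The constant of the bound must not depend on the dimensions \<open>p\<close> and \<open>d\<close>, so these are natural
  numbers and not types. A vector in dimension \<open>p\<close> is a function of type \<open>nat \<Rightarrow> real\<close> that
  vanishes from index \<open>p\<close> on, i.e. a point of the library space \<^const>\<open>Euclidean_space\<close>; an
  \<open>a \<times> b\<close> matrix is a function \<open>nat \<Rightarrow> nat \<Rightarrow> real\<close> of which only the entries \<open>(i, j)\<close> with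
  \<open>i < a\<close>, \<open>j < b\<close> are used.
\<close>

type_synonym rvec = "nat \<Rightarrow> real"
type_synonym rmat = "nat \<Rightarrow> nat \<Rightarrow> real"

abbreviation Rn :: "nat \<Rightarrow> rvec set" where
  "Rn p \<equiv> topspace (Euclidean_space p)"

definition vnorm :: "nat \<Rightarrow> rvec \<Rightarrow> real" where
  "vnorm n x = L2_set x {..<n}"

definition frob_norm :: "nat \<Rightarrow> rmat \<Rightarrow> real" where
  "frob_norm d Q = L2_set (\<lambda>(i, j). Q i j) ({..<d} \<times> {..<d})"

definition op_norm :: "nat \<Rightarrow> nat \<Rightarrow> rmat \<Rightarrow> real" where
  "op_norm a b A =
     (SUP v\<in>{v \<in> Rn b. vnorm b v \<le> 1}. vnorm a (\<lambda>i. \<Sum>j<b. A i j * v j))"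

definition quad_form :: "nat \<Rightarrow> rmat \<Rightarrow> rvec \<Rightarrow> real" where
  "quad_form d Q v = (\<Sum>i<d. \<Sum>j<d. v i * Q i j * v j)"

definition sym_psd :: "nat \<Rightarrow> rmat \<Rightarrow> bool" where
  "sym_psd d Q \<longleftrightarrow>
     (\<forall>i<d. \<forall>j<d. Q i j = Q j i) \<and> (\<forall>v\<in>Rn d. 0 \<le> quad_form d Q v)"

definition partial_deriv :: "(rvec \<Rightarrow> real) \<Rightarrow> nat \<Rightarrow> rvec \<Rightarrow> real" where
  "partial_deriv g j x = deriv (\<lambda>s. g (x(j := s))) (x j)"

definition grad :: "nat \<Rightarrow> (rvec \<Rightarrow> real) \<Rightarrow> rvec \<Rightarrow> rvec" where
  "grad p V x = (\<lambda>j. if j < p then partial_deriv V j x else 0)"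

definition jacobian_mat :: "(rvec \<Rightarrow> rvec) \<Rightarrow> rvec \<Rightarrow> rmat" where
  "jacobian_mat m x = (\<lambda>i j. partial_deriv (\<lambda>y. m y i) j x)"

definition monomial_map :: "nat \<Rightarrow> nat \<Rightarrow> (rvec \<Rightarrow> rvec) \<Rightarrow> bool" where
  "monomial_map p d m \<longleftrightarrow>
     (\<exists>\<alpha> :: nat \<Rightarrow> nat \<Rightarrow> nat.
        \<forall>x\<in>Rn p. m x = (\<lambda>i. if i < d then \<Prod>j<p. x j ^ \<alpha> i j else 0))"

definition sos_class :: "nat \<Rightarrow> (rvec \<Rightarrow> rvec) \<Rightarrow> real \<Rightarrow> (rvec \<Rightarrow> real) set" where
  "sos_class d m B\<^sub>Q =
     {\<lambda>x. quad_form d Q (m x) |Q. sym_psd d Q \<and> frob_norm d Q \<le> B\<^sub>Q}"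

text \<open>
  \<open>y\<close> solves the system on \<open>J\<close> with time derivative \<open>y'\<close>. Derivatives are taken within \<open>J\<close>, hence
  one-sided at the endpoints. Carrying \<open>y'\<close> keeps the notion meaningful for the degenerate
  interval \<open>J = {0}\<close>, where only the equation \<open>y' 0 = f (y 0)\<close> pins it down.
\<close>

definition ode_solution ::
    "nat \<Rightarrow> (rvec \<Rightarrow> rvec) \<Rightarrow> rvec \<Rightarrow> real set \<Rightarrow> (real \<Rightarrow> rvec) \<Rightarrow> (real \<Rightarrow> rvec) \<Rightarrow> bool" where
  "ode_solution p f \<xi> J y y' \<longleftrightarrow>
     y 0 = \<xi> \<and>
     (\<forall>t\<in>J. y t \<in> Rn p \<and> y' t = f (y t) \<and>
        (\<forall>i<p. ((\<lambda>s. y s i) has_real_derivative y' t i) (at t within J)))"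

definition unique_solution_upto :: "nat \<Rightarrow> (rvec \<Rightarrow> rvec) \<Rightarrow> rvec \<Rightarrow> real \<Rightarrow> bool" where
  "unique_solution_upto p f \<xi> t \<longleftrightarrow>
     (\<exists>y y'. ode_solution p f \<xi> {0..t} y y' \<and>
        (\<forall>z z'. ode_solution p f \<xi> {0..t} z z' \<longrightarrow> (\<forall>s\<in>{0..t}. z s = y s)))"

definition solution_interval :: "nat \<Rightarrow> (rvec \<Rightarrow> rvec) \<Rightarrow> rvec set \<Rightarrow> real set \<Rightarrow> bool" where
  "solution_interval p f X J \<longleftrightarrow>
     is_interval J \<and> 0 \<in> J \<and> J \<subseteq> {0..} \<and> (\<forall>\<xi>\<in>X. \<forall>t\<in>J. unique_solution_upto p f \<xi> t)"

definition maximal_solution_interval ::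
    "nat \<Rightarrow> (rvec \<Rightarrow> rvec) \<Rightarrow> rvec set \<Rightarrow> real set \<Rightarrow> bool" where
  "maximal_solution_interval p f X T \<longleftrightarrow>
     solution_interval p f X T \<and> (\<forall>J. solution_interval p f X J \<and> T \<subseteq> J \<longrightarrow> J = T)"

definition cert_value ::
    "nat \<Rightarrow> (rvec \<Rightarrow> rvec \<Rightarrow> real \<Rightarrow> rvec \<Rightarrow> real) \<Rightarrow> (real \<Rightarrow> rvec \<Rightarrow> rvec) \<Rightarrow> (real \<Rightarrow> rvec \<Rightarrow> rvec) \<Rightarrow>
     (rvec \<Rightarrow> real) \<Rightarrow> rvec \<Rightarrow> real \<Rightarrow> real" where
  "cert_value p h \<phi> \<phi>' V \<xi> t =
     h (\<phi> t \<xi>) (\<phi>' t \<xi>) (V (\<phi> t \<xi>)) (grad p V (\<phi> t \<xi>))"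

text \<open>
  The maximum over \<open>T\<close> is read as a supremum, since \<open>T\<close> need not be compact.
\<close>

definition err ::
    "nat \<Rightarrow> (rvec \<Rightarrow> rvec \<Rightarrow> real \<Rightarrow> rvec \<Rightarrow> real) \<Rightarrow> (real \<Rightarrow> rvec \<Rightarrow> rvec) \<Rightarrow> (real \<Rightarrow> rvec \<Rightarrow> rvec) \<Rightarrow>
     real set \<Rightarrow> rvec measure \<Rightarrow> (rvec \<Rightarrow> real) \<Rightarrow> real" where
  "err p h \<phi> \<phi>' T D V =
     measure D {\<xi> \<in> space D. (SUP t\<in>T. cert_value p h \<phi> \<phi>' V \<xi> t) > 0}"

text \<open>
  The logarithms of \<open>d\<close>, \<open>n\<close> and \<open>B\<^sub>h / \<gamma>\<close> in the bound are truncated below at 1, because the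
  bound fails with plain logarithms that vanish or are negative (\<open>d = 1\<close>, \<open>n = 1\<close>, or \<open>B\<^sub>h\<close> close
  to \<open>\<gamma>\<close>). For \<open>d \<ge> 2\<close>, \<open>n \<ge> 2\<close>, \<open>B\<^sub>h \<ge> e \<gamma>\<close> this changes the bound by at most a constant factor.
\<close>

definition log1 :: "real \<Rightarrow> real" where
  "log1 x = max 1 (ln x)"

end

theory Submission
  imports Defs
begin

text \<open>
  The difference \<open>A\<close> of two admissible matrices enters \<open>h\<close> only through bilinear expressions
  \<open>u\<^sup>T A v\<close> with \<open>u\<close>, \<open>v\<close> among \<open>m x\<close> and directional derivatives of \<open>m\<close>, so closeness of matrices
  in operator norm makes the certificate conditions uniformly close on \<open>S\<close>. The Frobenius ball of
  radius \<open>B\<close> has an operator norm \<open>\<epsilon>\<close>-net of log-cardinality \<open>O(d B\<^sup>2 / \<epsilon>\<^sup>2)\<close>, by greedy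
  deflation: subtract \<open>\<epsilon> u v\<^sup>T\<close> as long as some grid vectors \<open>u\<close>, \<open>v\<close> of the unit ball have
  \<open>u\<^sup>T Q v > \<epsilon>\<close>. With \<open>\<epsilon>\<close> proportional to \<open>\<gamma>\<close>, one feasible member of a cell forces all members
  of the cell to be nonpositive on the sample, and the union bound over cells gives the rate \<open>1/n\<close>.
\<close>

section \<open>Bilinear forms, Euclidean norms and the Frobenius norm\<close>

definition bilin :: "nat \<Rightarrow> rmat \<Rightarrow> rvec \<Rightarrow> rvec \<Rightarrow> real" where
  "bilin d A u v = (\<Sum>i<d. \<Sum>j<d. u i * A i j * v j)"

lemma quad_form_eq_bilin: "quad_form d A v = bilin d A v v"
  by (simp add: quad_form_def bilin_def)

lemma bilin_diff_left: "bilin d A (\<lambda>i. u i - u' i) v = bilin d A u v - bilin d A u' v"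
  by (simp add: bilin_def algebra_simps sum_subtractf)

lemma bilin_diff_right: "bilin d A u (\<lambda>i. v i - v' i) = bilin d A u v - bilin d A u v'"
  by (simp add: bilin_def algebra_simps sum_subtractf)

lemma bilin_diff_matrix: "bilin d (\<lambda>i j. A i j - A' i j) u v = bilin d A u v - bilin d A' u v"
  by (simp add: bilin_def algebra_simps sum_subtractf)

lemma bilin_scale_left: "bilin d A (\<lambda>i. c * u i) v = c * bilin d A u v"
  by (simp add: bilin_def algebra_simps sum_distrib_left)

lemma bilin_scale_right: "bilin d A u (\<lambda>i. c * v i) = c * bilin d A u v"
  by (simp add: bilin_def algebra_simps sum_distrib_left)

lemma bilin_uminus_left: "bilin d A (\<lambda>i. - u i) v = - bilin d A u v"
  using bilin_scale_left[of d A "-1" u v] by simp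

lemma vnorm_nonneg [simp]: "0 \<le> vnorm d u"
  by (simp add: vnorm_def)

lemma frob_norm_nonneg [simp]: "0 \<le> frob_norm d A"
  by (simp add: frob_norm_def)

lemma vnorm_power2: "(vnorm d u)\<^sup>2 = (\<Sum>i<d. (u i)\<^sup>2)"
  by (simp add: vnorm_def L2_set_def sum_nonneg)

lemma frob_norm_power2: "(frob_norm d A)\<^sup>2 = (\<Sum>i<d. \<Sum>j<d. (A i j)\<^sup>2)"
  by (simp add: frob_norm_def L2_set_def sum_nonneg sum.cartesian_product split_def)

lemma vnorm_scale: "vnorm d (\<lambda>i. c * u i) = \<bar>c\<bar> * vnorm d u"
proof (rule power2_eq_imp_eq)
  show "(vnorm d (\<lambda>i. c * u i))\<^sup>2 = (\<bar>c\<bar> * vnorm d u)\<^sup>2"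
    by (simp add: vnorm_power2 power_mult_distrib sum_distrib_left)
qed auto

lemma vnorm_uminus: "vnorm d (\<lambda>i. - u i) = vnorm d u"
  using vnorm_scale[of d "-1" u] by simp

text \<open>Cauchy-Schwarz over index pairs: \<open>bilin d A u v\<close> is the entrywise inner
  product of \<open>A\<close> with the rank-one matrix of entries \<open>u i * v j\<close>, whose
  Frobenius norm is \<open>vnorm d u * vnorm d v\<close>.\<close>

lemma abs_bilin_le_frob_norm: "\<bar>bilin d A u v\<bar> \<le> frob_norm d A * (vnorm d u * vnorm d v)"
proof -
  let ?I = "{..<d} \<times> {..<d}"
  let ?A = "\<lambda>(i, j). A i j" and ?w = "\<lambda>(i, j). u i * v j"
  have "L2_set ?w ?I = vnorm d u * vnorm d v"
  proof (rule power2_eq_imp_eq)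
    show "(L2_set ?w ?I)\<^sup>2 = (vnorm d u * vnorm d v)\<^sup>2"
      by (simp add: L2_set_def sum_nonneg split_def power_mult_distrib vnorm_power2
          sum_product sum.cartesian_product)
  qed auto
  moreover have "\<bar>bilin d A u v\<bar> \<le> (\<Sum>x\<in>?I. \<bar>?A x\<bar> * \<bar>?w x\<bar>)"
  proof -
    have "bilin d A u v = (\<Sum>x\<in>?I. ?A x * ?w x)"
      by (simp add: bilin_def sum.cartesian_product split_def algebra_simps)
    then show ?thesis
      by (metis (no_types, lifting) abs_mult sum.cong sum_abs)
  qed
  ultimately show ?thesis
    using L2_set_mult_ineq[of ?A ?w ?I] by (simp add: frob_norm_def)
qed

section \<open>A finite grid in the unit ball and its size\<close>

text \<open>
  The mesh \<open>1 / (4 sqrt d)\<close> approximates unit vectors within \<open>1/4\<close>, while squared norm at most \<open>1\<close>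
  means integer coordinates with \<open>\<Sum>z\<^sub>i\<^sup>2 \<le> 16 d\<close>. Since \<open>\<bar>z\<bar> \<le> z\<^sup>2\<close> on integers, there are at most
  \<open>2\<^bsup>16d\<^esup> 3\<^sup>d = 196608\<^sup>d\<close> of these.
\<close>

definition unit_grid :: "nat \<Rightarrow> rvec set" where
  "unit_grid d = {u \<in> Rn d. vnorm d u \<le> 1 \<and> (\<forall>i. u i * (4 * sqrt d) \<in> \<int>)}"

lemma zero_in_unit_grid: "(\<lambda>_. 0) \<in> unit_grid d"
  by (simp add: unit_grid_def topspace_Euclidean_space vnorm_def L2_set_def)

lemma uminus_in_unit_grid: "u \<in> unit_grid d \<Longrightarrow> (\<lambda>i. - u i) \<in> unit_grid d"
  by (auto simp: unit_grid_def topspace_Euclidean_space vnorm_uminus)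

text \<open>Rounding every coordinate towards zero to a multiple of the mesh cannot increase its
  absolute value, so the result stays in the unit ball. Each coordinate moves by at most
  \<open>1 / (4 * sqrt d)\<close>, and \<open>d\<close> such squared errors add up to at most
  \<open>1 / 16\<close>.\<close>

lemma unit_grid_approx:
  assumes "vnorm d u \<le> 1"
  obtains u' where "u' \<in> unit_grid d" "vnorm d (\<lambda>i. u i - u' i) \<le> 1 / 4"
proof -
  define s where "s = 4 * sqrt (real d)"
  define k where "k i = (if 0 \<le> u i then \<lfloor>u i * s\<rfloor> else \<lceil>u i * s\<rceil>)" for i
  define u' where "u' = (\<lambda>i. if i < d then k i / s else 0)"
  \<comment> \<open>For \<open>d = 0\<close> the scale \<open>s\<close> is zero, so positivity is
    claimed only in the presence of an index.\<close>
  have s: "s > 0" if "i < d" for i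
    using that by (simp add: s_def)
  have k: "\<bar>k i\<bar> \<le> \<bar>u i * s\<bar> \<and> \<bar>u i * s - k i\<bar> \<le> 1" if "i < d" for i
  proof (cases "0 \<le> u i")
    case True
    then have "0 \<le> u i * s" using s[OF that] by simp
    then show ?thesis using True unfolding k_def by (simp; linarith)
  next
    case False
    then have "u i * s \<le> 0" using s[OF that] by (simp add: mult_le_0_iff)
    then show ?thesis using False unfolding k_def by (simp; linarith)
  qed
  have u'_le: "\<bar>u' i\<bar> \<le> \<bar>u i\<bar>" and diff: "\<bar>u i - u' i\<bar> \<le> 1 / s" if "i < d" for i
  proof -
    show "\<bar>u' i\<bar> \<le> \<bar>u i\<bar>"
      using k[OF that] s[OF that] that by (simp add: u'_def abs_mult field_simps)
    have "u i - u' i = (u i * s - k i) / s"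
      using s[OF that] that by (simp add: u'_def field_simps)
    then show "\<bar>u i - u' i\<bar> \<le> 1 / s"
      using k[OF that] s[OF that] by (simp add: divide_right_mono)
  qed
  have "(vnorm d u')\<^sup>2 \<le> (vnorm d u)\<^sup>2"
    unfolding vnorm_power2 by (intro sum_mono) (simp add: u'_le abs_le_square_iff[symmetric])
  then have "vnorm d u' \<le> vnorm d u"
    by (rule power2_le_imp_le) simp
  moreover have "u' i * (4 * sqrt d) \<in> \<int>" for i
    using s[of i] by (auto simp: u'_def s_def)
  ultimately have "u' \<in> unit_grid d"
    using assms by (auto simp: unit_grid_def topspace_Euclidean_space u'_def)
  moreover have "(vnorm d (\<lambda>i. u i - u' i))\<^sup>2 \<le> (1 / 4)\<^sup>2"
  proof -
    have "(\<Sum>i<d. (u i - u' i)\<^sup>2) \<le> (\<Sum>i<d. (1 / s)\<^sup>2)"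
      using diff by (intro sum_mono) (metis abs_le_square_iff abs_of_pos lessThan_iff s zero_less_divide_1_iff)
    also have "\<dots> \<le> (1 / 4)\<^sup>2"
      by (simp add: s_def power_divide power_mult_distrib)
    finally show ?thesis by (simp add: vnorm_power2)
  qed
  then have "vnorm d (\<lambda>i. u i - u' i) \<le> 1 / 4"
    by (rule power2_le_imp_le) simp
  ultimately show ?thesis using that by blast
qed

lemma sum_half_power_abs_le: "(\<Sum>k\<in>{- int K..int K}. (1 / 2 :: real) ^ nat \<bar>k\<bar>) \<le> 3"
proof -
  \<comment> \<open>The exact value carries the induction; the bound \<open>3\<close> alone would
    not be inductive.\<close>
  have "(\<Sum>k\<in>{- int K..int K}. (1 / 2 :: real) ^ nat \<bar>k\<bar>) = 3 - 2 * (1 / 2) ^ K"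
  proof (induction K)
    case (Suc K)
    have "{- int (Suc K)..int (Suc K)} = insert (- int (Suc K)) (insert (int (Suc K)) {- int K..int K})"
      by auto
    then show ?case using Suc by (simp add: nat_add_distrib)
  qed auto
  then show ?thesis by simp
qed

text \<open>Weighted counting: on \<open>Z\<close> every weight \<open>?w z\<close> is at least
  \<open>(1 / 2) ^ K\<close>, while over the whole box the weights sum to a product of
  \<open>d\<close> two-sided geometric sums, each at most \<open>3\<close>.\<close>

lemma card_int_vectors_le:
  fixes d K :: nat
  defines "Z \<equiv> {z \<in> {..<d} \<rightarrow>\<^sub>E {- int K..int K}. (\<Sum>i<d. nat \<bar>z i\<bar>) \<le> K}"
  shows "real (card Z) \<le> 2 ^ K * 3 ^ d"
proof -
  let ?P = "{..<d} \<rightarrow>\<^sub>E {- int K..int K}"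
  let ?w = "\<lambda>z :: nat \<Rightarrow> int. \<Prod>i<d. (1 / 2 :: real) ^ nat \<bar>z i\<bar>"
  have fin: "finite ?P" by (simp add: finite_PiE)
  have "real (card Z) * (1 / 2) ^ K = (\<Sum>z\<in>Z. (1 / 2) ^ K)"
    by simp
  also have "\<dots> \<le> (\<Sum>z\<in>Z. ?w z)"
    by (rule sum_mono) (auto simp: Z_def power_sum[symmetric] intro!: power_decreasing)
  also have "\<dots> \<le> (\<Sum>z\<in>?P. ?w z)"
  proof (rule sum_mono2[OF fin])
    show "Z \<subseteq> ?P" by (auto simp: Z_def)
    show "0 \<le> ?w z" for z by (rule prod_nonneg) simp
  qed
  also have "\<dots> = (\<Prod>i<d. \<Sum>k\<in>{- int K..int K}. (1 / 2) ^ nat \<bar>k\<bar>)"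
    by (rule prod_sum_PiE[symmetric]) auto
  also have "\<dots> \<le> (\<Prod>i<d. 3)"
    by (intro prod_mono conjI sum_half_power_abs_le sum_nonneg) auto
  finally show ?thesis by (simp add: power_one_over field_simps)
qed

lemma card_unit_grid: "finite (unit_grid d)" "real (card (unit_grid d)) \<le> 196608 ^ d"
proof -
  define s where "s = 4 * sqrt (real d)"
  define K where "K = 16 * d"
  define Z where "Z = {z \<in> {..<d} \<rightarrow>\<^sub>E {- int K..int K}. (\<Sum>i<d. nat \<bar>z i\<bar>) \<le> K}"
  define g where "g = (\<lambda>u :: rvec. \<lambda>i\<in>{..<d}. \<lfloor>u i * s\<rfloor>)"
  \<comment> \<open>Scaled grid coordinates are integers, so taking the floor loses nothing; this
    gives both the bound on the sum of squares and injectivity of \<open>g\<close>.\<close>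
  have exact: "real_of_int \<lfloor>u i * s\<rfloor> = u i * s" if "u \<in> unit_grid d" for u i
    using that by (auto simp: unit_grid_def s_def elim!: Ints_cases)
  have "g ` unit_grid d \<subseteq> Z"
  proof safe
    fix u assume u: "u \<in> unit_grid d"
    have "real (\<Sum>i<d. nat \<bar>\<lfloor>u i * s\<rfloor>\<bar>) \<le> (\<Sum>i<d. (real_of_int \<lfloor>u i * s\<rfloor>)\<^sup>2)"
    proof -
      have "real (nat \<bar>k\<bar>) \<le> (real_of_int k)\<^sup>2" for k
      proof (cases "k = 0")
        case False
        then have "1 \<le> \<bar>k\<bar>" by simp
        then have "\<bar>k\<bar> * 1 \<le> \<bar>k\<bar> * \<bar>k\<bar>" by (intro mult_left_mono) auto
        then have "\<bar>k\<bar> \<le> k\<^sup>2" by (simp add: power2_eq_square)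
        then show ?thesis by (metis abs_ge_zero of_int_le_iff of_int_power of_nat_nat)
      qed simp
      then show ?thesis by (simp add: sum_mono)
    qed
    also have "\<dots> = (vnorm d u)\<^sup>2 * s\<^sup>2"
      by (simp add: exact[OF u] vnorm_power2 power_mult_distrib sum_distrib_right)
    also have "\<dots> \<le> 1 * s\<^sup>2"
      using u by (intro mult_right_mono) (auto simp: unit_grid_def power_le_one)
    also have "\<dots> = real K"
      by (simp add: s_def K_def power_mult_distrib)
    finally have le: "(\<Sum>i<d. nat \<bar>\<lfloor>u i * s\<rfloor>\<bar>) \<le> K"
      by linarith
    moreover have "\<lfloor>u i * s\<rfloor> \<in> {- int K..int K}" if "i < d" for i
    proof -
      have "nat \<bar>\<lfloor>u i * s\<rfloor>\<bar> \<le> (\<Sum>i<d. nat \<bar>\<lfloor>u i * s\<rfloor>\<bar>)"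
        using that by (intro member_le_sum) auto
      with le show ?thesis by auto
    qed
    ultimately show "g u \<in> Z"
      by (auto simp: Z_def g_def)
  qed
  moreover have "inj_on g (unit_grid d)"
  proof (rule inj_onI, rule ext)
    fix u v i assume uv: "u \<in> unit_grid d" "v \<in> unit_grid d" "g u = g v"
    show "u i = v i"
    proof (cases "i < d")
      case True
      then have "\<lfloor>u i * s\<rfloor> = \<lfloor>v i * s\<rfloor>"
        using fun_cong[OF uv(3), of i] by (simp add: g_def)
      then have "u i * s = v i * s"
        using exact uv by metis
      then show ?thesis using True by (simp add: s_def)
    next
      case False
      then show ?thesis using uv by (auto simp: unit_grid_def topspace_Euclidean_space)
    qed
  qed
  moreover have "finite Z"
    by (rule finite_subset[of _ "{..<d} \<rightarrow>\<^sub>E {- int K..int K}"]) (auto simp: Z_def finite_PiE)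
  ultimately show "finite (unit_grid d)" and "real (card (unit_grid d)) \<le> 196608 ^ d"
  proof -
    assume *: "g ` unit_grid d \<subseteq> Z" "inj_on g (unit_grid d)" "finite Z"
    show "finite (unit_grid d)" using * by (metis finite_imageD finite_subset)
    have "real (card (unit_grid d)) \<le> real (card Z)" using * by (simp add: card_inj_on_le)
    also have "\<dots> \<le> 2 ^ K * 3 ^ d" unfolding Z_def by (rule card_int_vectors_le)
    also have "\<dots> = (2 ^ 16 * 3) ^ d" by (simp only: K_def power_mult power_mult_distrib)
    finally show "real (card (unit_grid d)) \<le> 196608 ^ d" by simp
  qed
qed

text \<open>Net argument: let \<open>s\<close> be the supremum of the form over the unit ball.
  Replacing \<open>u\<close> and then \<open>v\<close> by grid points within \<open>1 / 4\<close>
  costs at most \<open>s / 4\<close> each time, so \<open>s \<le> \<epsilon> + s / 2\<close>, hence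
  \<open>s \<le> 2 * \<epsilon>\<close>.\<close>

lemma abs_bilin_le_unit_grid:
  assumes grid: "\<And>u v. u \<in> unit_grid d \<Longrightarrow> v \<in> unit_grid d \<Longrightarrow> \<bar>bilin d A u v\<bar> \<le> \<epsilon>"
  shows "\<bar>bilin d A u v\<bar> \<le> 2 * \<epsilon> * vnorm d u * vnorm d v"
proof -
  define W where "W = {\<bar>bilin d A u v\<bar> |u v. vnorm d u \<le> 1 \<and> vnorm d v \<le> 1}"
  define s where "s = Sup W"
  \<comment> \<open>A supremum of reals is informative only for a bounded set; the Frobenius norm
    supplies the bound.\<close>
  have bdd: "bdd_above W"
  proof (rule bdd_aboveI)
    fix x assume "x \<in> W"
    then obtain u v where "x = \<bar>bilin d A u v\<bar>" "vnorm d u \<le> 1" "vnorm d v \<le> 1"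
      by (auto simp: W_def)
    moreover from this have "frob_norm d A * (vnorm d u * vnorm d v) \<le> frob_norm d A * 1"
      by (intro mult_left_mono mult_le_one) auto
    ultimately show "x \<le> frob_norm d A"
      using abs_bilin_le_frob_norm[of d A u v] by simp
  qed
  have unit: "\<bar>bilin d A u v\<bar> \<le> s" if "vnorm d u \<le> 1" "vnorm d v \<le> 1" for u v
    unfolding s_def using that by (intro cSup_upper bdd) (auto simp: W_def)
  \<comment> \<open>Homogeneity: short vectors get a proportionally smaller bound, which is what the
    rounding errors need.\<close>
  have scaled: "\<bar>bilin d A u v\<bar> \<le> s * vnorm d u * vnorm d v" for u v
  proof (cases "vnorm d u = 0 \<or> vnorm d v = 0")
    case True
    then show ?thesis using abs_bilin_le_frob_norm[of d A u v] by auto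
  next
    case False
    define a where "a = vnorm d u"
    define b where "b = vnorm d v"
    have ab: "a > 0" "b > 0" using False by (auto simp: a_def b_def less_le)
    have "\<bar>bilin d A (\<lambda>i. inverse a * u i) (\<lambda>i. inverse b * v i)\<bar> \<le> s"
      using ab by (intro unit) (simp_all add: vnorm_scale flip: a_def b_def)
    then have "\<bar>inverse a * (inverse b * bilin d A u v)\<bar> \<le> s"
      by (simp only: bilin_scale_left bilin_scale_right)
    then show ?thesis
      using ab by (simp add: abs_mult field_simps flip: a_def b_def)
  qed
  have "s \<le> \<epsilon> + s / 2"
    unfolding s_def
  proof (rule cSup_least)
    have "\<bar>bilin d A (\<lambda>_. 0) (\<lambda>_. 0)\<bar> \<in> W"
      unfolding W_def by (auto simp: vnorm_def L2_set_def intro!: exI[of _ "\<lambda>_. 0"])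
    then show "W \<noteq> {}" by auto
    fix x assume "x \<in> W"
    then obtain u v where x: "x = \<bar>bilin d A u v\<bar>" "vnorm d u \<le> 1" "vnorm d v \<le> 1"
      by (auto simp: W_def)
    obtain u' where u': "u' \<in> unit_grid d" "vnorm d (\<lambda>i. u i - u' i) \<le> 1 / 4"
      using unit_grid_approx[OF x(2)] .
    obtain v' where v': "v' \<in> unit_grid d" "vnorm d (\<lambda>i. v i - v' i) \<le> 1 / 4"
      using unit_grid_approx[OF x(3)] .
    have s: "0 \<le> s" using unit[of "\<lambda>_. 0" "\<lambda>_. 0"] by (simp add: vnorm_def L2_set_def)
    have quarter: "\<bar>bilin d A a b\<bar> \<le> s / 4"
      if "vnorm d a * vnorm d b \<le> 1 / 4" for a b
    proof -
      have "s * (vnorm d a * vnorm d b) \<le> s * (1 / 4)"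
        using that s by (rule mult_left_mono)
      then show ?thesis using scaled[of a b] by (simp add: mult.assoc)
    qed
    have "\<bar>bilin d A (\<lambda>i. u i - u' i) v\<bar> \<le> s / 4"
    proof (rule quarter)
      show "vnorm d (\<lambda>i. u i - u' i) * vnorm d v \<le> 1 / 4"
        using mult_mono[OF u'(2) x(3)] by simp
    qed
    moreover have "\<bar>bilin d A u' (\<lambda>i. v i - v' i)\<bar> \<le> s / 4"
    proof (rule quarter)
      have "vnorm d u' \<le> 1" using u' by (simp add: unit_grid_def)
      then show "vnorm d u' * vnorm d (\<lambda>i. v i - v' i) \<le> 1 / 4"
        using mult_mono[OF _ v'(2), of "vnorm d u'" 1] by simp
    qed
    moreover have "\<bar>bilin d A u' v'\<bar> \<le> \<epsilon>" using grid u' v' by blast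
    ultimately have "x \<le> \<epsilon> + s / 2"
      unfolding x bilin_diff_left bilin_diff_right by linarith
    then show "x \<le> \<epsilon> + Sup W / 2" by (simp add: s_def)
  qed
  then have "s \<le> 2 * \<epsilon>" by simp
  then have "s * (vnorm d u * vnorm d v) \<le> 2 * \<epsilon> * (vnorm d u * vnorm d v)"
    by (intro mult_right_mono) auto
  then show ?thesis using scaled[of u v] by (simp add: mult.assoc)
qed

section \<open>Covering the Frobenius ball by greedy deflation\<close>

text \<open>Expanding the square leaves \<open>\<epsilon>\<^sup>2\<close> multiplied by the squared
  norms of \<open>u\<close> and \<open>v\<close>, a factor of at most \<open>1\<close>. For positive
  \<open>\<epsilon>\<close>, a bilinear value above \<open>\<epsilon>\<close> therefore lowers the
  squared norm by more than \<open>\<epsilon>\<^sup>2\<close>.\<close>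

lemma frob_norm_diff_rank_one:
  assumes "vnorm d u \<le> 1" "vnorm d v \<le> 1"
  shows "(frob_norm d (\<lambda>i j. A i j - \<epsilon> * (u i * v j)))\<^sup>2
      \<le> (frob_norm d A)\<^sup>2 - 2 * \<epsilon> * bilin d A u v + \<epsilon>\<^sup>2"
proof -
  have "(frob_norm d (\<lambda>i j. A i j - \<epsilon> * (u i * v j)))\<^sup>2 =
      (frob_norm d A)\<^sup>2 - 2 * \<epsilon> * bilin d A u v + \<epsilon>\<^sup>2 * ((vnorm d u)\<^sup>2 * (vnorm d v)\<^sup>2)"
  proof -
    have "(frob_norm d (\<lambda>i j. A i j - \<epsilon> * (u i * v j)))\<^sup>2 = (\<Sum>i<d. \<Sum>j<d.
        (A i j)\<^sup>2 - 2 * \<epsilon> * (u i * A i j * v j) + \<epsilon>\<^sup>2 * ((u i)\<^sup>2 * (v j)\<^sup>2))"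
      unfolding frob_norm_power2
      by (intro sum.cong refl) (simp add: power2_eq_square algebra_simps)
    also have "\<dots> = (frob_norm d A)\<^sup>2 - 2 * \<epsilon> * bilin d A u v +
        \<epsilon>\<^sup>2 * ((vnorm d u)\<^sup>2 * (vnorm d v)\<^sup>2)"
      by (simp only: frob_norm_power2 bilin_def vnorm_power2 sum.distrib sum_subtractf
          sum_distrib_left[symmetric] sum_distrib_right[symmetric])
    finally show ?thesis .
  qed
  moreover have "(vnorm d u)\<^sup>2 * (vnorm d v)\<^sup>2 \<le> 1"
    using assms by (intro mult_le_one power_le_one) auto
  then have "\<epsilon>\<^sup>2 * ((vnorm d u)\<^sup>2 * (vnorm d v)\<^sup>2) \<le> \<epsilon>\<^sup>2"
    by (rule mult_left_le) simp
  ultimately show ?thesis by linarith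
qed

text \<open>
  Greedy rank-one deflation: subtracting \<open>\<epsilon> u v\<^sup>T\<close> with \<open>u\<^sup>T A v > \<epsilon>\<close> lowers the squared Frobenius
  norm by at least \<open>\<epsilon>\<^sup>2\<close>, which can happen at most \<open>r\<close> times.
\<close>

lemma frob_ball_cover_grid:
  assumes "\<epsilon> > 0"
  shows "\<exists>F. finite F \<and> (\<lambda>_ _. 0) \<in> F \<and> real (card F) \<le> (196608 ^ (2 * d)) ^ r \<and>
    (\<forall>A. (frob_norm d A)\<^sup>2 < (real r + 1) * \<epsilon>\<^sup>2 \<longrightarrow>
      (\<exists>P\<in>F. \<forall>u\<in>unit_grid d. \<forall>v\<in>unit_grid d. \<bar>bilin d (\<lambda>i j. A i j - P i j) u v\<bar> \<le> \<epsilon>))"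
proof (induction r)
  case 0
  \<comment> \<open>With no deflation left the Frobenius norm is below \<open>\<epsilon>\<close>, so
    the zero matrix alone is a cover.\<close>
  have "\<bar>bilin d A u v\<bar> \<le> \<epsilon>"
    if "(frob_norm d A)\<^sup>2 < \<epsilon>\<^sup>2" "u \<in> unit_grid d" "v \<in> unit_grid d" for A u v
  proof -
    have "frob_norm d A < \<epsilon>"
      using that assms by (intro power2_less_imp_less[of "frob_norm d A" \<epsilon>]) auto
    moreover have "frob_norm d A * (vnorm d u * vnorm d v) \<le> frob_norm d A * 1"
      using that by (intro mult_left_mono mult_le_one) (auto simp: unit_grid_def)
    ultimately show ?thesis
      using abs_bilin_le_frob_norm[of d A u v] by linarith
  qed
  then show ?case by (intro exI[of _ "{\<lambda>_ _. 0}"]) auto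
next
  case (Suc r)
  then obtain F where F: "finite F" "(\<lambda>_ _. 0) \<in> F" "real (card F) \<le> (196608 ^ (2 * d)) ^ r"
    and cover: "\<And>A. (frob_norm d A)\<^sup>2 < (real r + 1) * \<epsilon>\<^sup>2 \<Longrightarrow>
      \<exists>P\<in>F. \<forall>u\<in>unit_grid d. \<forall>v\<in>unit_grid d. \<bar>bilin d (\<lambda>i j. A i j - P i j) u v\<bar> \<le> \<epsilon>"
    by blast
  let ?N = "unit_grid d"
  \<comment> \<open>Undoes a deflation: a centre for the deflated matrix becomes a centre for
    \<open>A\<close>. All grid pairs are tried, so each round multiplies the number of centres by at
    most the square of the grid size.\<close>
  define step where "step = (\<lambda>(P :: rmat, u :: rvec, v :: rvec) i j. P i j + \<epsilon> * (u i * v j))"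
  define F' where "F' = step ` (F \<times> ?N \<times> ?N)"
  have "finite F'"
    by (simp add: F'_def F card_unit_grid)
  \<comment> \<open>The zero centre survives through zero vectors; it serves the matrices that are
    already small on the grid.\<close>
  moreover have "(\<lambda>_ _. 0) \<in> F'"
    unfolding F'_def using F zero_in_unit_grid
    by (intro image_eqI[of _ _ "(\<lambda>_ _. 0, \<lambda>_. 0, \<lambda>_. 0)"]) (auto simp: step_def)
  moreover have "real (card F') \<le> (196608 ^ (2 * d)) ^ Suc r"
  proof -
    have "real (card F') \<le> real (card (F \<times> ?N \<times> ?N))"
      unfolding F'_def using F card_unit_grid by (intro of_nat_mono card_image_le) auto
    also have "\<dots> = real (card F) * (real (card ?N) * real (card ?N))"
      by (simp add: card_cartesian_product)
    also have "\<dots> \<le> (196608 ^ (2 * d)) ^ r * (196608 ^ d * 196608 ^ d)"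
      using F card_unit_grid[of d] by (intro mult_mono) auto
    also have "\<dots> = (196608 ^ (2 * d)) ^ Suc r"
      by (simp add: mult_2 power_add)
    finally show ?thesis .
  qed
  moreover have "\<exists>P\<in>F'. \<forall>u\<in>?N. \<forall>v\<in>?N. \<bar>bilin d (\<lambda>i j. A i j - P i j) u v\<bar> \<le> \<epsilon>"
    if A: "(frob_norm d A)\<^sup>2 < (real (Suc r) + 1) * \<epsilon>\<^sup>2" for A
  proof (cases "\<forall>u\<in>?N. \<forall>v\<in>?N. \<bar>bilin d A u v\<bar> \<le> \<epsilon>")
    case True
    then show ?thesis using \<open>(\<lambda>_ _. 0) \<in> F'\<close> by (intro bexI[of _ "\<lambda>_ _. 0"]) auto
  next
    case False
    then obtain u0 v where 1: "u0 \<in> ?N" "v \<in> ?N" "\<bar>bilin d A u0 v\<bar> > \<epsilon>" by force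
    \<comment> \<open>The grid is symmetric, so negating \<open>u0\<close> turns a large negative
      value into a large positive one.\<close>
    obtain u where u: "u \<in> ?N" "bilin d A u v > \<epsilon>"
    proof (cases "bilin d A u0 v > \<epsilon>")
      case False
      then have "bilin d A (\<lambda>i. - u0 i) v > \<epsilon>" using 1 by (simp add: bilin_uminus_left)
      then show ?thesis using that uminus_in_unit_grid[OF 1(1)] by blast
    qed (use 1 in blast)
    let ?A = "\<lambda>i j. A i j - \<epsilon> * (u i * v j)"
    have "(frob_norm d ?A)\<^sup>2 \<le> (frob_norm d A)\<^sup>2 - 2 * \<epsilon> * bilin d A u v + \<epsilon>\<^sup>2"
      using u 1 by (intro frob_norm_diff_rank_one) (auto simp: unit_grid_def)
    moreover have "\<epsilon> * \<epsilon> \<le> \<epsilon> * bilin d A u v"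
      using u assms by (intro mult_left_mono) auto
    ultimately have "(frob_norm d ?A)\<^sup>2 < (real r + 1) * \<epsilon>\<^sup>2"
      using A by (simp add: algebra_simps power2_eq_square)
    then obtain P where P: "P \<in> F" "\<forall>u\<in>?N. \<forall>v\<in>?N. \<bar>bilin d (\<lambda>i j. ?A i j - P i j) u v\<bar> \<le> \<epsilon>"
      using cover by blast
    have "(\<lambda>i j. A i j - step (P, u, v) i j) = (\<lambda>i j. ?A i j - P i j)"
      by (intro ext) (simp add: step_def)
    then show ?thesis
      using P u 1 unfolding F'_def by (intro bexI[of _ "step (P, u, v)"]) auto
  qed
  ultimately show ?case by (intro exI[of _ F'] conjI allI impI)
qed

text \<open>Passing from grid vectors to arbitrary ones costs the factor \<open>2\<close>. Positive
  cardinality is recorded because the probability bound takes \<open>ln (card F)\<close> and divides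
  by \<open>card F\<close>.\<close>

lemma frob_ball_cover:
  assumes "\<epsilon> > 0" "B\<^sup>2 < (real r + 1) * \<epsilon>\<^sup>2"
  obtains F where "finite F" "card F > 0" "real (card F) \<le> (196608 ^ (2 * d)) ^ r"
    "\<And>A. frob_norm d A \<le> B \<Longrightarrow>
      \<exists>P\<in>F. \<forall>u v. \<bar>bilin d (\<lambda>i j. A i j - P i j) u v\<bar> \<le> 2 * \<epsilon> * vnorm d u * vnorm d v"
proof -
  obtain F where F: "finite F" "(\<lambda>_ _. 0) \<in> F" "real (card F) \<le> (196608 ^ (2 * d)) ^ r"
    and cover: "\<And>A. (frob_norm d A)\<^sup>2 < (real r + 1) * \<epsilon>\<^sup>2 \<Longrightarrow>
      \<exists>P\<in>F. \<forall>u\<in>unit_grid d. \<forall>v\<in>unit_grid d. \<bar>bilin d (\<lambda>i j. A i j - P i j) u v\<bar> \<le> \<epsilon>"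
    using frob_ball_cover_grid[OF assms(1), of d r] by (elim exE conjE) blast
  show ?thesis
  proof (rule that[OF F(1) _ F(3)])
    show "card F > 0" using F by (auto simp: card_gt_0_iff)
    fix A assume "frob_norm d A \<le> B"
    then have "(frob_norm d A)\<^sup>2 \<le> B\<^sup>2" by (intro power_mono) auto
    with assms(2) have "(frob_norm d A)\<^sup>2 < (real r + 1) * \<epsilon>\<^sup>2" by linarith
    then obtain P where "P \<in> F"
      "\<forall>u\<in>unit_grid d. \<forall>v\<in>unit_grid d. \<bar>bilin d (\<lambda>i j. A i j - P i j) u v\<bar> \<le> \<epsilon>"
      using cover by blast
    then show "\<exists>P\<in>F. \<forall>u v. \<bar>bilin d (\<lambda>i j. A i j - P i j) u v\<bar>
        \<le> 2 * \<epsilon> * vnorm d u * vnorm d v"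
      by (intro bexI[of _ P] allI abs_bilin_le_unit_grid) auto
  qed
qed

section \<open>Union bound for i.i.d. samples\<close>

text \<open>
  The union bound behind the realizable case: a sample of size \<open>n\<close> misses a fixed event of
  probability more than \<open>\<tau>\<close> with probability at most \<open>(1 - \<tau>)\<^sup>n\<close>.
\<close>

lemma (in prob_space) sample_hits_finite_family:
  assumes F: "finite F" and A: "\<And>q. q \<in> F \<Longrightarrow> A q \<in> events"
    and p: "\<And>q. q \<in> F \<Longrightarrow> prob (A q) > \<tau>" and "0 \<le> \<tau>"
  obtains E where "E \<in> sets (\<Pi>\<^sub>M i\<in>{..<n}. M)"
    "measure (\<Pi>\<^sub>M i\<in>{..<n}. M) E \<ge> 1 - real (card F) * exp (- \<tau> * real n)"
    "\<And>\<omega> q. \<omega> \<in> E \<Longrightarrow> q \<in> F \<Longrightarrow> \<exists>i<n. \<omega> i \<in> A q"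
proof -
  interpret P: product_prob_space "\<lambda>_. M" "{..<n}"
    by standard
  interpret P: finite_product_prob_space "\<lambda>_. M" "{..<n}"
    by standard auto
  define miss where "miss q = (\<Pi>\<^sub>E i\<in>{..<n}. space M - A q)" for q
  define E where "E = space (\<Pi>\<^sub>M i\<in>{..<n}. M) - (\<Union>q\<in>F. miss q)"
  have sets: "miss q \<in> sets (\<Pi>\<^sub>M i\<in>{..<n}. M)" if "q \<in> F" for q
    unfolding miss_def using A[OF that] by (intro sets_PiM_I_finite) auto
  then have Union: "(\<Union>q\<in>F. miss q) \<in> sets (\<Pi>\<^sub>M i\<in>{..<n}. M)"
    using F by (intro sets.finite_UN) auto
  have miss: "P.prob (miss q) \<le> exp (- \<tau> * real n)" if "q \<in> F" for q
  proof -
    have "P.prob (miss q) = (1 - prob (A q)) ^ n"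
      unfolding miss_def using A[OF that] by (simp add: P.prob_times prob_compl)
    also have "\<dots> \<le> exp (- \<tau>) ^ n"
    proof (rule power_mono)
      have "1 - prob (A q) \<le> 1 - \<tau>" using p[OF that] by simp
      also have "\<dots> \<le> exp (- \<tau>)" using exp_ge_add_one_self[of "- \<tau>"] by simp
      finally show "1 - prob (A q) \<le> exp (- \<tau>)" .
    qed simp
    finally show ?thesis by (simp add: exp_of_nat_mult[symmetric] mult.commute)
  qed
  have "P.prob (\<Union>q\<in>F. miss q) \<le> (\<Sum>q\<in>F. P.prob (miss q))"
    using F sets by (intro P.finite_measure_subadditive_finite) auto
  also have "\<dots> \<le> real (card F) * exp (- \<tau> * real n)"
    using sum_mono[OF miss] by simp
  finally have "P.prob E \<ge> 1 - real (card F) * exp (- \<tau> * real n)"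
    unfolding E_def using Union by (simp add: P.prob_compl)
  moreover have "E \<in> sets (\<Pi>\<^sub>M i\<in>{..<n}. M)"
    unfolding E_def using Union by auto
  moreover have "\<exists>i<n. \<omega> i \<in> A q" if "\<omega> \<in> E" "q \<in> F" for \<omega> q
  proof (rule ccontr)
    assume "\<not> ?thesis"
    then have "\<omega> \<in> miss q"
      using that by (auto simp: E_def miss_def space_PiM PiE_iff)
    then show False using that by (auto simp: E_def)
  qed
  ultimately show ?thesis using that by blast
qed

section \<open>Monomial maps: derivatives and bounds on compact sets\<close>

text \<open>Only the factor of index \<open>j\<close> depends on \<open>s\<close>. For
  \<open>a j = 0\<close> the truncated exponent \<open>a j - 1\<close> is harmless, since the factor
  \<open>real (a j)\<close> vanishes.\<close>

lemma monomial_has_partial_deriv: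
  fixes x :: rvec
  assumes "j < p"
  shows "((\<lambda>s. \<Prod>l<p. (x(j := s)) l ^ a l) has_real_derivative
      real (a j) * x j ^ (a j - 1) * (\<Prod>l\<in>{..<p} - {j}. x l ^ a l)) (at (x j))"
proof -
  have "(\<lambda>s. \<Prod>l<p. (x(j := s)) l ^ a l) = (\<lambda>s. s ^ a j * (\<Prod>l\<in>{..<p} - {j}. x l ^ a l))"
  proof
    fix s
    show "(\<Prod>l<p. (x(j := s)) l ^ a l) = s ^ a j * (\<Prod>l\<in>{..<p} - {j}. x l ^ a l)"
      using assms by (subst prod.remove[of _ j]) (auto intro!: prod.cong)
  qed
  then show ?thesis by (auto intro!: derivative_eq_intros)
qed

context
  fixes p d :: nat and m :: "rvec \<Rightarrow> rvec"
  assumes m: "monomial_map p d m"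
begin

text \<open>\<open>monomial_map\<close> determines \<open>m\<close> only on \<open>Rn p\<close>.
  Changing a coordinate below \<open>p\<close> does not leave this set, so the monomial formula
  holds along the whole line of differentiation.\<close>

lemma monomial_map_has_partial_deriv:
  assumes "x \<in> Rn p" "j < p" "i < d"
  shows "((\<lambda>s. m (x(j := s)) i) has_real_derivative jacobian_mat m x i j) (at (x j))"
proof -
  obtain a where "\<forall>x\<in>Rn p. m x = (\<lambda>i. if i < d then \<Prod>j<p. x j ^ a i j else 0)"
    using m unfolding monomial_map_def by blast
  moreover have "x(j := s) \<in> Rn p" for s
    using assms by (auto simp: topspace_Euclidean_space)
  ultimately have "(\<lambda>s. m (x(j := s)) i) = (\<lambda>s. \<Prod>l<p. (x(j := s)) l ^ a i l)"
    using assms by auto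
  then show ?thesis
    using monomial_has_partial_deriv[OF assms(2), of x "a i"]
    by (simp add: jacobian_mat_def partial_deriv_def DERIV_imp_deriv)
qed

text \<open>Product rule, one term for each copy of \<open>m x\<close>. In this form the gradient is
  accessible to bounds on \<open>bilin\<close>.\<close>

lemma grad_quad_form:
  assumes "x \<in> Rn p" "j < p"
  shows "grad p (\<lambda>x. quad_form d Q (m x)) x j =
    bilin d Q (\<lambda>i. jacobian_mat m x i j) (m x) + bilin d Q (m x) (\<lambda>i. jacobian_mat m x i j)"
proof -
  have "((\<lambda>s. quad_form d Q (m (x(j := s)))) has_real_derivative
      (\<Sum>i<d. \<Sum>k<d. jacobian_mat m x i j * Q i k * m x k + m x i * Q i k * jacobian_mat m x k j))
      (at (x j))"
    unfolding quad_form_def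
  proof (intro DERIV_sum)
    fix i k assume ik: "i \<in> {..<d}" "k \<in> {..<d}"
    show "((\<lambda>s. m (x(j := s)) i * Q i k * m (x(j := s)) k) has_real_derivative
        jacobian_mat m x i j * Q i k * m x k + m x i * Q i k * jacobian_mat m x k j) (at (x j))"
      using ik assms
      by (auto intro!: derivative_eq_intros monomial_map_has_partial_deriv simp: algebra_simps)
  qed
  then show ?thesis
    using assms by (simp add: grad_def partial_deriv_def DERIV_imp_deriv bilin_def sum.distrib)
qed

text \<open>Each coordinate is bounded on the compact set \<open>S\<close>, and inserting these
  bounds dominates the monomials and their derivatives. This makes the suprema
  \<open>B\<^sub>m\<close> and \<open>B\<^sub>D\<^sub>m\<close> genuine upper bounds.\<close>

lemma monomial_map_bounded:
  assumes "compactin (Euclidean_space p) S"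
  shows "bdd_above ((\<lambda>x. vnorm d (m x)) ` S)"
    and "\<exists>K. \<forall>x\<in>S. \<forall>i<d. \<forall>j<p. \<bar>jacobian_mat m x i j\<bar> \<le> K"
proof -
  obtain a where a: "\<And>x. x \<in> Rn p \<Longrightarrow> m x = (\<lambda>i. if i < d then \<Prod>j<p. x j ^ a i j else 0)"
    using m unfolding monomial_map_def by blast
  have SR: "S \<subseteq> Rn p"
    using assms by (rule compactin_subset_topspace)
  have "\<exists>R. \<forall>x\<in>S. \<bar>x j\<bar> \<le> R" for j
  proof -
    have "continuous_map (Euclidean_space p) euclideanreal (\<lambda>x. x j)"
      unfolding Euclidean_space_def
      by (intro continuous_map_from_subtopology continuous_map_product_projection) auto
    then have "compact ((\<lambda>x. x j) ` S)"
      using image_compactin[OF assms] by fastforce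
    then have "bounded ((\<lambda>x. x j) ` S)" by (rule compact_imp_bounded)
    then show ?thesis unfolding bounded_iff by auto
  qed
  then obtain R where R: "\<And>x j. x \<in> S \<Longrightarrow> \<bar>x j\<bar> \<le> R j" by metis
  have pow: "\<bar>x j\<bar> ^ k \<le> R j ^ k" if "x \<in> S" for x j k
    using R[OF that] by (intro power_mono) auto
  have prod: "(\<Prod>l\<in>L. \<bar>x l\<bar> ^ b l) \<le> (\<Prod>l\<in>L. R l ^ b l)" if "x \<in> S" for x L b
    using pow[OF that] by (intro prod_mono) auto
  show "bdd_above ((\<lambda>x. vnorm d (m x)) ` S)"
  proof (rule bdd_aboveI2)
    fix x assume x: "x \<in> S"
    have "vnorm d (m x) \<le> (\<Sum>i<d. \<bar>m x i\<bar>)"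
      unfolding vnorm_def by (rule L2_set_le_sum_abs)
    also have "\<dots> \<le> (\<Sum>i<d. \<Prod>l<p. R l ^ a i l)"
      using x SR prod[OF x] by (intro sum_mono) (auto simp: a abs_prod power_abs)
    finally show "vnorm d (m x) \<le> (\<Sum>i<d. \<Prod>l<p. R l ^ a i l)" .
  qed
  define G where
    "G i j = real (a i j) * R j ^ (a i j - 1) * (\<Prod>l\<in>{..<p} - {j}. R l ^ a i l)" for i j
  have jac: "\<bar>jacobian_mat m x i j\<bar> \<le> G i j" if x: "x \<in> S" and ij: "i < d" "j < p" for x i j
  proof -
    have "x(j := s) \<in> Rn p" for s
      using x SR ij by (auto simp: topspace_Euclidean_space)
    then have "(\<lambda>s. m (x(j := s)) i) = (\<lambda>s. \<Prod>l<p. (x(j := s)) l ^ a i l)"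
      using ij by (auto simp: a)
    then have "jacobian_mat m x i j =
        real (a i j) * x j ^ (a i j - 1) * (\<Prod>l\<in>{..<p} - {j}. x l ^ a i l)"
      using monomial_has_partial_deriv[OF ij(2), of x "a i"]
      by (simp add: jacobian_mat_def partial_deriv_def DERIV_imp_deriv)
    also have "\<bar>\<dots>\<bar> \<le> G i j"
      unfolding G_def abs_mult abs_prod power_abs abs_of_nat
    proof (intro mult_mono pow[OF x] prod[OF x])
      \<comment> \<open>The point \<open>x\<close> of \<open>S\<close> forces the bounds to be
        nonnegative; on an empty \<open>S\<close> they would be arbitrary.\<close>
      have "0 \<le> R l" for l
        using R[OF x, of l] by linarith
      then show "0 \<le> real (a i j) * R j ^ (a i j - 1)" by simp
    qed (auto intro!: prod_nonneg)
    finally show ?thesis .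
  qed
  show "\<exists>K. \<forall>x\<in>S. \<forall>i<d. \<forall>j<p. \<bar>jacobian_mat m x i j\<bar> \<le> K"
  proof (intro exI ballI allI impI)
    fix x i j assume "x \<in> S" "i < d" "j < p"
    then have "\<bar>jacobian_mat m x i j\<bar> \<le> G i j" by (rule jac)
    also have "\<dots> \<le> \<bar>G i j\<bar>" by simp
    also have "\<dots> \<le> (\<Sum>j<p. \<bar>G i j\<bar>)" using \<open>j < p\<close> by (intro member_le_sum) auto
    also have "\<dots> \<le> (\<Sum>i<d. \<Sum>j<p. \<bar>G i j\<bar>)"
      using \<open>i < d\<close> by (intro member_le_sum[of i "{..<d}" "\<lambda>i. \<Sum>j<p. \<bar>G i j\<bar>"]) (auto intro: sum_nonneg)
    finally show "\<bar>jacobian_mat m x i j\<bar> \<le> (\<Sum>i<d. \<Sum>j<p. \<bar>G i j\<bar>)" .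
  qed
qed

end

section \<open>Operator norms and the norm of a gradient\<close>

text \<open>Crude, but uniform in \<open>v\<close>: it serves to show that suprema are finite and
  does not enter the final rate.\<close>

lemma vnorm_matrix_vector_le:
  assumes "\<And>i j. i < a \<Longrightarrow> j < b \<Longrightarrow> \<bar>A i j\<bar> \<le> K" "vnorm b v \<le> 1"
  shows "vnorm a (\<lambda>i. \<Sum>j<b. A i j * v j) \<le> real a * (real b * K)"
proof -
  have "vnorm a (\<lambda>i. \<Sum>j<b. A i j * v j) \<le> (\<Sum>i<a. \<bar>\<Sum>j<b. A i j * v j\<bar>)"
    unfolding vnorm_def by (rule L2_set_le_sum_abs)
  also have "\<dots> \<le> (\<Sum>i<a. \<Sum>j<b. K)"
  proof (rule sum_mono)
    fix i assume i: "i \<in> {..<a}"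
    have "\<bar>\<Sum>j<b. A i j * v j\<bar> \<le> (\<Sum>j<b. \<bar>A i j * v j\<bar>)" by (rule sum_abs)
    also have "\<dots> \<le> (\<Sum>j<b. K)"
    proof (rule sum_mono)
      fix j assume j: "j \<in> {..<b}"
      have "\<bar>v j\<bar> \<le> vnorm b v"
        using member_le_L2_set[of "{..<b}" j "\<lambda>i. \<bar>v i\<bar>"] j by (simp add: vnorm_def L2_set_def)
      then have "\<bar>v j\<bar> \<le> 1" using assms(2) by simp
      then have "\<bar>A i j\<bar> * \<bar>v j\<bar> \<le> K * 1"
        using assms(1)[of i j] i j by (intro mult_mono) auto
      then show "\<bar>A i j * v j\<bar> \<le> K" by (simp add: abs_mult)
    qed
    finally show "\<bar>\<Sum>j<b. A i j * v j\<bar> \<le> (\<Sum>j<b. K)" .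
  qed
  finally show ?thesis by simp
qed

lemma op_norm_le:
  assumes "\<And>i j. i < a \<Longrightarrow> j < b \<Longrightarrow> \<bar>A i j\<bar> \<le> K"
  shows "op_norm a b A \<le> real a * (real b * K)"
  unfolding op_norm_def
proof (rule cSUP_least)
  show "{v \<in> Rn b. vnorm b v \<le> 1} \<noteq> {}"
    by (auto simp: topspace_Euclidean_space vnorm_def L2_set_def intro!: exI[of _ "\<lambda>_. 0"])
qed (use vnorm_matrix_vector_le[OF assms] in auto)

lemma bdd_above_op_norm: "bdd_above ((\<lambda>v. vnorm a (\<lambda>i. \<Sum>j<b. A i j * v j)) ` {v \<in> Rn b. vnorm b v \<le> 1})"
proof (rule bdd_aboveI2)
  fix v assume v: "v \<in> {v \<in> Rn b. vnorm b v \<le> 1}"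
  show "vnorm a (\<lambda>i. \<Sum>j<b. A i j * v j) \<le> real a * (real b * (\<Sum>i<a. \<Sum>j<b. \<bar>A i j\<bar>))"
  proof (rule vnorm_matrix_vector_le)
    fix i j assume "i < a" "j < b"
    have "\<bar>A i j\<bar> \<le> (\<Sum>j<b. \<bar>A i j\<bar>)" using \<open>j < b\<close> by (intro member_le_sum) auto
    also have "\<dots> \<le> (\<Sum>i<a. \<Sum>j<b. \<bar>A i j\<bar>)"
      using \<open>i < a\<close> by (intro member_le_sum[of i "{..<a}" "\<lambda>i. \<Sum>j<b. \<bar>A i j\<bar>"]) (auto intro: sum_nonneg)
    finally show "\<bar>A i j\<bar> \<le> (\<Sum>i<a. \<Sum>j<b. \<bar>A i j\<bar>)" .
  qed (use v in auto)
qed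

lemma op_norm_nonneg: "0 \<le> op_norm a b A"
proof -
  have "vnorm a (\<lambda>i. \<Sum>j<b. A i j * 0) \<le> op_norm a b A"
    unfolding op_norm_def
    by (rule cSUP_upper2[OF bdd_above_op_norm, of "\<lambda>_. 0"])
      (auto simp: topspace_Euclidean_space vnorm_def L2_set_def)
  then show ?thesis using vnorm_nonneg order_trans by blast
qed

lemma vnorm_le_op_norm:
  assumes "v \<in> Rn b"
  shows "vnorm a (\<lambda>i. \<Sum>j<b. A i j * v j) \<le> op_norm a b A * vnorm b v"
proof (cases "vnorm b v = 0")
  case True
  then have "v j = 0" if "j < b" for j
    using that by (simp add: vnorm_def L2_set_eq_0_iff)
  then have "(\<lambda>i. \<Sum>j<b. A i j * v j) = (\<lambda>_. 0)" by simp
  then show ?thesis using True by (simp add: vnorm_def L2_set_def)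
next
  case False
  define c where "c = vnorm b v"
  have c: "c > 0" using False vnorm_nonneg[of b v] by (simp add: c_def less_le)
  have "vnorm a (\<lambda>i. \<Sum>j<b. A i j * (inverse c * v j)) \<le> op_norm a b A"
    unfolding op_norm_def
    using c assms
    by (intro cSUP_upper2[OF bdd_above_op_norm, of "\<lambda>j. inverse c * v j"])
      (auto simp: topspace_Euclidean_space vnorm_scale c_def[symmetric])
  moreover have "(\<lambda>i. \<Sum>j<b. A i j * (inverse c * v j)) = (\<lambda>i. inverse c * (\<Sum>j<b. A i j * v j))"
    by (simp add: sum_distrib_left mult_ac)
  ultimately have "inverse c * vnorm a (\<lambda>i. \<Sum>j<b. A i j * v j) \<le> op_norm a b A"
    using c by (simp add: vnorm_scale)
  then show ?thesis using c by (simp add: field_simps flip: c_def)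
qed

text \<open>Turns a pairing of \<open>w\<close> with a gradient into a form at the directional
  derivative \<open>J w\<close>, to which the operator norm of \<open>J\<close> applies.\<close>

lemma sum_mult_bilin_left: "(\<Sum>j<p. w j * bilin d A (\<lambda>i. J i j) v) = bilin d A (\<lambda>i. \<Sum>j<p. J i j * w j) v"
proof -
  have "(\<Sum>j<p. w j * bilin d A (\<lambda>i. J i j) v) = (\<Sum>j<p. \<Sum>i<d. \<Sum>k<d. J i j * w j * A i k * v k)"
    by (simp add: bilin_def sum_distrib_left mult_ac)
  also have "\<dots> = (\<Sum>i<d. \<Sum>j<p. \<Sum>k<d. J i j * w j * A i k * v k)"
    by (rule sum.swap)
  also have "\<dots> = (\<Sum>i<d. \<Sum>k<d. \<Sum>j<p. J i j * w j * A i k * v k)"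
    by (intro sum.cong refl sum.swap)
  finally show ?thesis by (simp add: bilin_def sum_distrib_right)
qed

lemma bilin_transpose: "bilin d (\<lambda>i j. A j i) u v = bilin d A v u"
  unfolding bilin_def by (subst sum.swap) (simp add: mult_ac)

lemma sum_mult_bilin_right: "(\<Sum>j<p. w j * bilin d A v (\<lambda>i. J i j)) = bilin d A v (\<lambda>i. \<Sum>j<p. J i j * w j)"
  using sum_mult_bilin_left[of w d "\<lambda>i j. A j i" J v p] by (simp only: bilin_transpose[of d A])

text \<open>Pair \<open>w\<close> with itself: its squared norm is the sum of the forms at
  \<open>(J w, y)\<close> and \<open>(y, J w)\<close>, hence at most \<open>2 * s\<close> times the
  norms of \<open>J\<close>, \<open>w\<close> and \<open>y\<close>. Cancelling one norm of
  \<open>w\<close> gives a bound without a factor depending on \<open>p\<close>, which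
  coordinatewise estimates would cost.\<close>

lemma vnorm_bilin_columns_le:
  assumes A: "\<And>u v. \<bar>bilin d A u v\<bar> \<le> s * vnorm d u * vnorm d v" and "0 \<le> s"
    and w: "w \<in> Rn p" "\<And>j. j < p \<Longrightarrow> w j = bilin d A (\<lambda>i. J i j) y + bilin d A y (\<lambda>i. J i j)"
  shows "vnorm p w \<le> 2 * s * op_norm d p J * vnorm d y"
proof -
  define z where "z = (\<lambda>i. \<Sum>j<p. J i j * w j)"
  have "(vnorm p w)\<^sup>2 = (\<Sum>j<p. w j * bilin d A (\<lambda>i. J i j) y) + (\<Sum>j<p. w j * bilin d A y (\<lambda>i. J i j))"
    unfolding vnorm_power2 sum.distrib[symmetric]
    by (intro sum.cong refl) (simp add: w(2) power2_eq_square distrib_left)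
  also have "\<dots> = bilin d A z y + bilin d A y z"
    by (simp add: sum_mult_bilin_left sum_mult_bilin_right z_def)
  also have "\<dots> \<le> 2 * (s * vnorm d z * vnorm d y)"
    using A[of z y] A[of y z] by (simp add: mult_ac)
  also have "\<dots> \<le> 2 * (s * (op_norm d p J * vnorm p w) * vnorm d y)"
    unfolding z_def using vnorm_le_op_norm[OF w(1), of d J] \<open>0 \<le> s\<close>
    by (intro mult_left_mono mult_right_mono) auto
  finally have "vnorm p w * vnorm p w \<le> vnorm p w * (2 * s * op_norm d p J * vnorm d y)"
    by (simp add: power2_eq_square mult_ac)
  moreover have "0 \<le> 2 * s * op_norm d p J * vnorm d y"
    using \<open>0 \<le> s\<close> op_norm_nonneg by simp
  ultimately show ?thesis
    using vnorm_nonneg[of p w] by (cases "vnorm p w = 0") (auto simp: mult_le_cancel_left)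
qed

section \<open>Generalization from a finite cover with a margin\<close>

text \<open>
  Only events \<open>{\<xi>. sup\<^sub>t g Q \<xi> t > 0}\<close> of positive measure enter the union bound, one per cell of
  the cover; these are measurable because \<open>measure\<close> is \<open>0\<close> outside the \<open>\<sigma>\<close>-algebra. Hence \<open>g\<close> itself
  need not be measurable.
\<close>

lemma (in prob_space) margin_cover_bound:
  fixes g :: "'q \<Rightarrow> 'a \<Rightarrow> 't \<Rightarrow> real" and near :: "'q \<Rightarrow> 'r \<Rightarrow> bool" and n :: nat
  assumes F: "finite F" "card F > 0" and "T \<noteq> {}" "\<gamma> > 0" "0 < \<delta>" "\<delta> < 1" "n \<ge> 1"
    and cover: "\<And>Q. Q \<in> \<Q> \<Longrightarrow> \<exists>P\<in>F. near Q P"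
    and close: "\<And>Q Q' P \<xi> t. Q \<in> \<Q> \<Longrightarrow> Q' \<in> \<Q> \<Longrightarrow> near Q P \<Longrightarrow> near Q' P \<Longrightarrow> \<xi> \<in> space M \<Longrightarrow> t \<in> T \<Longrightarrow>
      \<bar>g Q \<xi> t - g Q' \<xi> t\<bar> \<le> \<gamma> / 2"
  obtains E where "E \<in> sets (\<Pi>\<^sub>M i\<in>{..<n}. M)" "measure (\<Pi>\<^sub>M i\<in>{..<n}. M) E \<ge> 1 - \<delta>"
    "\<And>\<omega> Q. \<omega> \<in> E \<Longrightarrow> Q \<in> \<Q> \<Longrightarrow> (\<forall>i<n. \<forall>t\<in>T. g Q (\<omega> i) t \<le> - \<gamma>) \<Longrightarrow>
      prob {\<xi> \<in> space M. (SUP t\<in>T. g Q \<xi> t) > 0} \<le> (ln (card F) + ln (1 / \<delta>)) / n"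
proof -
  \<comment> \<open>The solution of \<open>card F * exp (- \<tau> * n) = \<delta>\<close>, so that
    the union bound fails with probability at most \<open>\<delta>\<close>.\<close>
  define \<tau> where "\<tau> = (ln (card F) + ln (1 / \<delta>)) / n"
  define A where "A Q = {\<xi> \<in> space M. (SUP t\<in>T. g Q \<xi> t) > 0}" for Q
  define bad where "bad P Q \<longleftrightarrow> Q \<in> \<Q> \<and> near Q P \<and> prob (A Q) > \<tau>" for P Q
  define F' where "F' = {P \<in> F. \<exists>Q. bad P Q}"
  \<comment> \<open>The representative of a cell is chosen independently of the sample, so the union
    bound concerns finitely many fixed events.\<close>
  define w where "w P = (SOME Q. bad P Q)" for P
  have card: "real (card F) \<ge> 1" using F by linarith
  have \<tau>: "0 \<le> \<tau>"
    using card assms by (simp add: \<tau>_def)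
  have w: "bad P (w P)" if "P \<in> F'" for P
    using that unfolding F'_def w_def by (auto intro: someI_ex)
  have F': "finite F'" "card F' \<le> card F"
    using F by (auto simp: F'_def intro: card_mono)
  have events: "A (w P) \<in> events" if "P \<in> F'" for P
    using w[OF that] \<tau> measure_notin_sets[of "A (w P)" M] by (fastforce simp: bad_def)
  obtain E where E: "E \<in> sets (\<Pi>\<^sub>M i\<in>{..<n}. M)"
    "measure (\<Pi>\<^sub>M i\<in>{..<n}. M) E \<ge> 1 - real (card F') * exp (- \<tau> * real n)"
    "\<And>\<omega> P. \<omega> \<in> E \<Longrightarrow> P \<in> F' \<Longrightarrow> \<exists>i<n. \<omega> i \<in> A (w P)"
    using sample_hits_finite_family[of F' "\<lambda>P. A (w P)" \<tau> n] F'(1) events w \<tau>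
    unfolding bad_def by blast
  have "exp (- \<tau> * real n) = \<delta> / card F"
  proof -
    have "- \<tau> * real n = ln (\<delta> / card F)"
      using F card assms(4-7) by (auto simp: \<tau>_def ln_div)
    then show ?thesis using card assms by simp
  qed
  then have "real (card F') * exp (- \<tau> * real n) = \<delta> * (card F' / card F)"
    by simp
  also have "\<dots> \<le> \<delta> * 1"
    using F' card assms by (intro mult_left_mono) (auto simp: divide_le_eq)
  finally have "measure (\<Pi>\<^sub>M i\<in>{..<n}. M) E \<ge> 1 - \<delta>"
    using E(2) by linarith
  moreover have "prob (A Q) \<le> \<tau>"
    if \<omega>: "\<omega> \<in> E" and Q: "Q \<in> \<Q>" and feas: "\<forall>i<n. \<forall>t\<in>T. g Q (\<omega> i) t \<le> - \<gamma>" for \<omega> Q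
  proof (rule ccontr)
    assume *: "\<not> ?thesis"
    \<comment> \<open>A bad \<open>Q\<close> makes its cell bad, so some sample point lies in the
      positive set of the representative \<open>w P\<close>. The margin \<open>\<gamma>\<close> of
      \<open>Q\<close> exceeds the variation \<open>\<gamma> / 2\<close> inside the cell, so
      \<open>w P\<close> is nonpositive at that very point.\<close>
    obtain P where P: "P \<in> F" "near Q P" using cover[OF Q] by blast
    then have P': "P \<in> F'" using * Q unfolding F'_def bad_def by auto
    obtain i where i: "i < n" "\<omega> i \<in> A (w P)" using E(3)[OF \<omega> P'] by blast
    have "(SUP t\<in>T. g (w P) (\<omega> i) t) \<le> 0"
    proof (rule cSUP_least[OF \<open>T \<noteq> {}\<close>])
      fix t assume t: "t \<in> T"
      have "\<bar>g Q (\<omega> i) t - g (w P) (\<omega> i) t\<bar> \<le> \<gamma> / 2"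
        using w[OF P'] P Q i t by (intro close[of Q "w P" P]) (auto simp: bad_def A_def)
      moreover have "g Q (\<omega> i) t \<le> - \<gamma>" using feas i t by blast
      ultimately show "g (w P) (\<omega> i) t \<le> 0" using \<open>\<gamma> > 0\<close> by linarith
    qed
    then show False using i(2) by (simp add: A_def)
  qed
  ultimately show ?thesis
    using that[OF E(1)] unfolding A_def \<tau>_def by blast
qed

section \<open>Sum-of-squares certificates and the final bound\<close>

text \<open>Value and gradient are linear in the matrix, so both differences are bilinear
  expressions in \<open>Q - Q'\<close>. The factor \<open>2\<close> comes from the two terms of the
  product rule.\<close>

lemma sos_certificates_close:
  assumes m: "monomial_map p d m" and x: "x \<in> Rn p" and "0 \<le> s"
    and s: "\<And>u v. \<bar>bilin d (\<lambda>i j. Q i j - Q' i j) u v\<bar> \<le> s * vnorm d u * vnorm d v"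
  shows "\<bar>quad_form d Q (m x) - quad_form d Q' (m x)\<bar> \<le> s * (vnorm d (m x))\<^sup>2"
    and "vnorm p (\<lambda>i. grad p (\<lambda>x. quad_form d Q (m x)) x i - grad p (\<lambda>x. quad_form d Q' (m x)) x i)
      \<le> 2 * s * op_norm d p (jacobian_mat m x) * vnorm d (m x)"
proof -
  show "\<bar>quad_form d Q (m x) - quad_form d Q' (m x)\<bar> \<le> s * (vnorm d (m x))\<^sup>2"
    using s[of "m x" "m x"]
    by (simp add: bilin_diff_matrix quad_form_eq_bilin power2_eq_square mult_ac)
  show "vnorm p (\<lambda>i. grad p (\<lambda>x. quad_form d Q (m x)) x i - grad p (\<lambda>x. quad_form d Q' (m x)) x i)
      \<le> 2 * s * op_norm d p (jacobian_mat m x) * vnorm d (m x)"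
  proof (rule vnorm_bilin_columns_le[OF s \<open>0 \<le> s\<close>])
    fix j assume "j < p"
    then show "grad p (\<lambda>x. quad_form d Q (m x)) x j - grad p (\<lambda>x. quad_form d Q' (m x)) x j =
        bilin d (\<lambda>i j. Q i j - Q' i j) (\<lambda>i. jacobian_mat m x i j) (m x) +
        bilin d (\<lambda>i j. Q i j - Q' i j) (m x) (\<lambda>i. jacobian_mat m x i j)"
      by (simp add: grad_quad_form[OF m x] bilin_diff_matrix)
  qed (auto simp: topspace_Euclidean_space grad_def)
qed

text \<open>Balances accuracy against size: \<open>\<epsilon> = \<gamma> / (16 * L * K)\<close> is
  the coarsest admissible scale, and the number of deflations is of order
  \<open>B\<^sup>2 / \<epsilon>\<^sup>2\<close>, whence \<open>256 = 16\<^sup>2\<close>.\<close>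

lemma cover_scale:
  fixes B L K \<gamma> :: real
  assumes "B > 0" "L \<ge> 0" "K \<ge> 0" "\<gamma> > 0"
  obtains \<epsilon> r where "\<epsilon> > 0" "B\<^sup>2 < (real r + 1) * \<epsilon>\<^sup>2" "16 * L * K * \<epsilon> \<le> \<gamma>"
    "real r \<le> 256 * (B\<^sup>2 * K\<^sup>2 * L\<^sup>2 / \<gamma>\<^sup>2)"
proof (cases "L * K = 0")
  case True
  \<comment> \<open>Here the accuracy requirement is void, so a radius beyond \<open>B\<close> with
    no deflation will do.\<close>
  have "B\<^sup>2 < (B + 1)\<^sup>2" using assms by (intro power_strict_mono) auto
  then show ?thesis
    using True assms by (intro that[of "B + 1" 0]) auto
next
  case False
  define \<epsilon> where "\<epsilon> = \<gamma> / (16 * L * K)"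
  \<comment> \<open>Rounding down keeps \<open>r\<close> below the quotient, while
    \<open>r + 1\<close> still exceeds it strictly, as the cover demands.\<close>
  define r where "r = nat \<lfloor>B\<^sup>2 / \<epsilon>\<^sup>2\<rfloor>"
  have \<epsilon>: "\<epsilon> > 0" using False assms by (simp add: \<epsilon>_def less_le)
  have r: "real r \<le> B\<^sup>2 / \<epsilon>\<^sup>2" "B\<^sup>2 / \<epsilon>\<^sup>2 < real r + 1"
    unfolding r_def by (auto simp: of_nat_floor)
  show ?thesis
  proof (rule that[OF \<epsilon>])
    show "B\<^sup>2 < (real r + 1) * \<epsilon>\<^sup>2" using r(2) \<epsilon> by (simp add: field_simps)
    show "16 * L * K * \<epsilon> \<le> \<gamma>" using False by (simp add: \<epsilon>_def)
    have "B\<^sup>2 / \<epsilon>\<^sup>2 = 256 * (B\<^sup>2 * K\<^sup>2 * L\<^sup>2 / \<gamma>\<^sup>2)"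
      using False assms by (simp add: \<epsilon>_def power_divide power_mult_distrib field_simps)
    then show "real r \<le> 256 * (B\<^sup>2 * K\<^sup>2 * L\<^sup>2 / \<gamma>\<^sup>2)" using r(1) by simp
  qed
qed

lemma one_le_log1 [simp]: "1 \<le> log1 x"
  by (simp add: log1_def)

lemma one_le_ln_196608: "1 \<le> ln (196608 :: real)"
proof -
  have "exp 1 \<le> (196608 :: real)" using exp_le by linarith
  then show ?thesis by (simp add: ln_ge_iff)
qed

text \<open>The event \<open>E\<close> is chosen before \<open>V\<close>, so the bound covers every
  solution of the sampled conditions at once, including one selected from the data.\<close>

lemma sos_generalization_bound:
  fixes p d n :: nat and D :: "rvec measure" and B\<^sub>h :: real
  assumes sol: "maximal_solution_interval p f X T"
    "\<forall>\<xi>\<in>X. ode_solution p f \<xi> T (\<lambda>t. \<phi> t \<xi>) (\<lambda>t. \<phi>' t \<xi>)"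
    and D: "prob_space D" "sets D = sets (restrict_space borel X)"
    and S: "compactin (Euclidean_space p) S" "\<forall>\<xi>\<in>X. \<forall>t\<in>T. \<phi> t \<xi> \<in> S"
    and m: "monomial_map p d m" and "B\<^sub>Q > 0"
    and B\<^sub>V: "\<forall>V\<in>sos_class d m B\<^sub>Q. \<forall>x\<in>S. \<bar>V x\<bar> \<le> B\<^sub>V"
    and B\<^sub>D\<^sub>V: "\<forall>V\<in>sos_class d m B\<^sub>Q. \<forall>x\<in>S. vnorm p (grad p V x) \<le> B\<^sub>D\<^sub>V"
    and "L\<^sub>h \<ge> 0"
    and lip: "\<forall>x\<in>S. \<forall>v v'. \<forall>w\<in>Rn p. \<forall>w'\<in>Rn p.
         \<bar>v\<bar> \<le> B\<^sub>V \<longrightarrow> \<bar>v'\<bar> \<le> B\<^sub>V \<longrightarrow> vnorm p w \<le> B\<^sub>D\<^sub>V \<longrightarrow> vnorm p w' \<le> B\<^sub>D\<^sub>V \<longrightarrow>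
         \<bar>h x (f x) v w - h x (f x) v' w'\<bar>
           \<le> L\<^sub>h * sqrt ((v - v')\<^sup>2 + (vnorm p (\<lambda>i. w i - w' i))\<^sup>2)"
    and "\<gamma> > 0" "0 < \<delta>" "\<delta> < 1" "n \<ge> 1"
  defines "B\<^sub>m \<equiv> SUP x\<in>S. vnorm d (m x)"
    and "B\<^sub>D\<^sub>m \<equiv> SUP x\<in>S. op_norm d p (jacobian_mat m x)"
  shows "\<exists>E\<in>sets (\<Pi>\<^sub>M i\<in>{..<n}. D).
            measure (\<Pi>\<^sub>M i\<in>{..<n}. D) E \<ge> 1 - \<delta> \<and>
            (\<forall>\<xi>\<in>E. \<forall>V\<in>sos_class d m B\<^sub>Q.
               (\<forall>i<n. \<forall>t\<in>T. cert_value p h \<phi> \<phi>' V (\<xi> i) t \<le> - \<gamma>) \<longrightarrow>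
               err p h \<phi> \<phi>' T D V
                 \<le> (512 * ln 196608) * (B\<^sub>Q\<^sup>2 * (B\<^sub>m\<^sup>2 + B\<^sub>D\<^sub>m * B\<^sub>m)\<^sup>2 * L\<^sub>h\<^sup>2 *
                          (real d * (log1 d)\<^sup>2 * (log1 n) ^ 3 / (\<gamma>\<^sup>2 * real n))
                        + ln (log1 (B\<^sub>h / \<gamma>) / \<delta>) / real n))"
proof -
  interpret D: prob_space D by fact
  have X: "space D = X"
    using sets_eq_imp_space_eq[OF D(2)] by (simp add: space_restrict_space)
  have "0 \<in> T"
    using sol by (simp add: maximal_solution_interval_def solution_interval_def)
  have SR: "S \<subseteq> Rn p" using S(1) by (rule compactin_subset_topspace)
  have Bm: "vnorm d (m x) \<le> B\<^sub>m" if "x \<in> S" for x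
    unfolding B\<^sub>m_def using that by (intro cSUP_upper monomial_map_bounded[OF m S(1)])
  have BDm: "op_norm d p (jacobian_mat m x) \<le> B\<^sub>D\<^sub>m" if "x \<in> S" for x
  proof -
    obtain K where "\<forall>x\<in>S. \<forall>i<d. \<forall>j<p. \<bar>jacobian_mat m x i j\<bar> \<le> K"
      using monomial_map_bounded(2)[OF m S(1)] by blast
    then have "bdd_above ((\<lambda>x. op_norm d p (jacobian_mat m x)) ` S)"
      by (intro bdd_aboveI2[of _ _ "real d * (real p * K)"] op_norm_le) auto
    then show ?thesis unfolding B\<^sub>D\<^sub>m_def using that by (intro cSUP_upper)
  qed
  \<comment> \<open>A probability space is nonempty, so some trajectory starts in \<open>X\<close>
    and lies in \<open>S\<close> at time \<open>0\<close>. Nonnegativity of the two suprema rests on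
    this point.\<close>
  obtain x0 where "x0 \<in> S"
    using D.not_empty X S(2) \<open>0 \<in> T\<close> by blast
  then have nonneg: "0 \<le> B\<^sub>m" "0 \<le> B\<^sub>D\<^sub>m"
    using Bm BDm vnorm_nonneg op_norm_nonneg order_trans by blast+
  define K where "K = B\<^sub>m\<^sup>2 + B\<^sub>D\<^sub>m * B\<^sub>m"
  have "0 \<le> K" using nonneg by (simp add: K_def)
  obtain \<epsilon> r where \<epsilon>: "\<epsilon> > 0" "B\<^sub>Q\<^sup>2 < (real r + 1) * \<epsilon>\<^sup>2" "16 * L\<^sub>h * K * \<epsilon> \<le> \<gamma>"
    and r: "real r \<le> 256 * (B\<^sub>Q\<^sup>2 * K\<^sup>2 * L\<^sub>h\<^sup>2 / \<gamma>\<^sup>2)"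
    using cover_scale[OF \<open>B\<^sub>Q > 0\<close> \<open>L\<^sub>h \<ge> 0\<close> \<open>0 \<le> K\<close> \<open>\<gamma> > 0\<close>] .
  obtain F where F: "finite F" "card F > 0" "real (card F) \<le> (196608 ^ (2 * d)) ^ r"
    and cover: "\<And>A. frob_norm d A \<le> B\<^sub>Q \<Longrightarrow>
      \<exists>P\<in>F. \<forall>u v. \<bar>bilin d (\<lambda>i j. A i j - P i j) u v\<bar> \<le> 2 * \<epsilon> * vnorm d u * vnorm d v"
    using frob_ball_cover[OF \<epsilon>(1,2), where d = d] by blast
  define \<Q> where "\<Q> = {Q. sym_psd d Q \<and> frob_norm d Q \<le> B\<^sub>Q}"
  define V where "V Q = (\<lambda>x. quad_form d Q (m x))" for Q
  define near where "near A P \<longleftrightarrow>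
    (\<forall>u v. \<bar>bilin d (\<lambda>i j. A i j - P i j) u v\<bar> \<le> 2 * \<epsilon> * vnorm d u * vnorm d v)" for A P
  have sos_class_eq: "sos_class d m B\<^sub>Q = V ` \<Q>"
    by (auto simp: sos_class_def V_def \<Q>_def)
  have close: "\<bar>cert_value p h \<phi> \<phi>' (V Q) \<xi> t - cert_value p h \<phi> \<phi>' (V Q') \<xi> t\<bar> \<le> \<gamma> / 2"
    if Q: "Q \<in> \<Q>" "Q' \<in> \<Q>" "near Q P" "near Q' P" and \<xi>: "\<xi> \<in> space D" and t: "t \<in> T"
    for Q Q' P \<xi> t
  proof -
    define x where "x = \<phi> t \<xi>"
    have x: "x \<in> S" using \<xi> t S(2) X by (auto simp: x_def)
    \<comment> \<open>Along a solution the time derivative is the vector field, so \<open>h\<close>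
      is evaluated exactly where \<open>lip\<close> speaks about it.\<close>
    have \<phi>': "\<phi>' t \<xi> = f x"
      using sol(2) \<xi> t X by (auto simp: ode_solution_def x_def)
    \<comment> \<open>Triangle inequality through the common centre \<open>P\<close>, adding two
      radii \<open>2 * \<epsilon>\<close>.\<close>
    have s: "\<bar>bilin d (\<lambda>i j. Q i j - Q' i j) u v\<bar> \<le> 4 * \<epsilon> * vnorm d u * vnorm d v" for u v
      using Q(3,4)[unfolded near_def, rule_format, of u v] by (simp add: bilin_diff_matrix)
    have xR: "x \<in> Rn p" using x SR by blast
    have "0 \<le> 4 * \<epsilon>" using \<epsilon> by simp
    note close = sos_certificates_close[OF m xR this s, folded V_def]
    let ?dV = "V Q x - V Q' x" and ?dG = "vnorm p (\<lambda>i. grad p (V Q) x i - grad p (V Q') x i)"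
    have "\<bar>?dV\<bar> \<le> 4 * \<epsilon> * (vnorm d (m x))\<^sup>2"
      using close(1) by (simp add: V_def)
    also have "\<dots> \<le> 4 * \<epsilon> * B\<^sub>m\<^sup>2"
      using \<epsilon> Bm[OF x] by (intro mult_left_mono power_mono) auto
    finally have dV: "\<bar>?dV\<bar> \<le> 4 * \<epsilon> * B\<^sub>m\<^sup>2" .
    have "?dG \<le> 8 * \<epsilon> * (op_norm d p (jacobian_mat m x) * vnorm d (m x))"
      using close(2) by (simp add: mult_ac)
    also have "\<dots> \<le> 8 * \<epsilon> * (B\<^sub>D\<^sub>m * B\<^sub>m)"
      using \<epsilon> Bm[OF x] BDm[OF x] nonneg op_norm_nonneg by (intro mult_left_mono mult_mono) auto
    finally have dG: "?dG \<le> 8 * \<epsilon> * (B\<^sub>D\<^sub>m * B\<^sub>m)" .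
    have "\<bar>h x (f x) (V Q x) (grad p (V Q) x) - h x (f x) (V Q' x) (grad p (V Q') x)\<bar>
        \<le> L\<^sub>h * sqrt (?dV\<^sup>2 + ?dG\<^sup>2)"
    proof -
      have "V Q \<in> sos_class d m B\<^sub>Q" "V Q' \<in> sos_class d m B\<^sub>Q" using Q by (auto simp: sos_class_eq)
      moreover have "grad p W x \<in> Rn p" for W
        by (auto simp: topspace_Euclidean_space grad_def)
      ultimately show ?thesis
        using lip x B\<^sub>V B\<^sub>D\<^sub>V by blast
    qed
    \<comment> \<open>The value contributes \<open>4 * \<epsilon> * B\<^sub>m\<^sup>2\<close> and
      the gradient \<open>8 * \<epsilon> * (B\<^sub>D\<^sub>m * B\<^sub>m)\<close>. Demanding half
      the margin for the total explains the \<open>16\<close> in \<open>cover_scale\<close>.\<close>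
    also have "\<dots> \<le> L\<^sub>h * (8 * \<epsilon> * K)"
    proof (rule mult_left_mono[OF _ \<open>L\<^sub>h \<ge> 0\<close>])
      have "sqrt (?dV\<^sup>2 + ?dG\<^sup>2) \<le> \<bar>?dV\<bar> + \<bar>?dG\<bar>"
        by (rule sqrt_sum_squares_le_sum_abs)
      also have "\<dots> \<le> 4 * \<epsilon> * B\<^sub>m\<^sup>2 + 8 * \<epsilon> * (B\<^sub>D\<^sub>m * B\<^sub>m)"
        using dV dG by simp
      also have "\<dots> \<le> 8 * \<epsilon> * K"
        using \<epsilon> by (simp add: K_def algebra_simps)
      finally show "sqrt (?dV\<^sup>2 + ?dG\<^sup>2) \<le> 8 * \<epsilon> * K" .
    qed
    also have "\<dots> \<le> \<gamma> / 2" using \<epsilon>(3) by (simp add: mult_ac)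
    finally show ?thesis by (simp add: cert_value_def \<phi>' flip: x_def)
  qed
  obtain E where E: "E \<in> sets (\<Pi>\<^sub>M i\<in>{..<n}. D)" "measure (\<Pi>\<^sub>M i\<in>{..<n}. D) E \<ge> 1 - \<delta>"
    "\<And>\<omega> Q. \<omega> \<in> E \<Longrightarrow> Q \<in> \<Q> \<Longrightarrow> (\<forall>i<n. \<forall>t\<in>T. cert_value p h \<phi> \<phi>' (V Q) (\<omega> i) t \<le> - \<gamma>) \<Longrightarrow>
      measure D {\<xi> \<in> space D. (SUP t\<in>T. cert_value p h \<phi> \<phi>' (V Q) \<xi> t) > 0}
        \<le> (ln (card F) + ln (1 / \<delta>)) / n"
  proof (rule D.margin_cover_bound[where F = F and T = T and \<gamma> = \<gamma> and \<delta> = \<delta> and n = n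
        and \<Q> = \<Q> and near = near and g = "\<lambda>Q. cert_value p h \<phi> \<phi>' (V Q)"])
    show "\<exists>P\<in>F. near Q P" if "Q \<in> \<Q>" for Q
      using cover[of Q] that by (simp add: \<Q>_def near_def)
    show "T \<noteq> {}" using \<open>0 \<in> T\<close> by blast
  qed (use F(1,2) \<open>\<gamma> > 0\<close> \<open>0 < \<delta>\<close> \<open>\<delta> < 1\<close> \<open>n \<ge> 1\<close> close in blast)+
  let ?C = "512 * ln 196608 :: real"
  have C: "1 \<le> ?C" using one_le_ln_196608 by linarith
  have bound: "(ln (card F) + ln (1 / \<delta>)) / n \<le> ?C * (B\<^sub>Q\<^sup>2 * K\<^sup>2 * L\<^sub>h\<^sup>2 *
      (real d * (log1 d)\<^sup>2 * (log1 n) ^ 3 / (\<gamma>\<^sup>2 * real n)) + ln (log1 (B\<^sub>h / \<gamma>) / \<delta>) / real n)"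
  proof -
    let ?R = "B\<^sub>Q\<^sup>2 * K\<^sup>2 * L\<^sub>h\<^sup>2 / \<gamma>\<^sup>2" and ?l = "(log1 d)\<^sup>2 * (log1 n) ^ 3"
    \<comment> \<open>The constant arises here: \<open>256\<close> from the bound on
      \<open>r\<close>, times the exponent \<open>2 * d\<close> per deflation, times
      \<open>ln 196608\<close>.\<close>
    have "ln (card F) \<le> ln ((196608 ^ (2 * d)) ^ r)"
      using F by (intro ln_mono) auto
    also have "\<dots> = real r * (2 * d * ln 196608)"
      by (simp add: ln_realpow)
    also have "\<dots> \<le> 256 * ?R * (2 * d * ln 196608)"
      using r one_le_ln_196608 by (intro mult_right_mono) auto
    also have "\<dots> = ?C * ?R * d" by simp
    also have "\<dots> \<le> ?C * ?R * (d * ?l)"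
    proof -
      \<comment> \<open>The truncated logarithms are at least \<open>1\<close>, so these factors may
        be inserted into the upper bound.\<close>
      have "1 \<le> ?l"
        using mult_mono[of 1 "(log1 d)\<^sup>2" 1 "(log1 n) ^ 3"] by (simp add: one_le_power)
      then have "real d * 1 \<le> d * ?l" by (intro mult_left_mono) auto
      then show ?thesis
        using C by (intro mult_left_mono mult_nonneg_nonneg) auto
    qed
    finally have 1: "ln (card F) \<le> ?C * ?R * (d * ?l)" .
    \<comment> \<open>Again \<open>log1\<close> is at least \<open>1\<close>; as
      \<open>\<delta> < 1\<close> makes the left side nonnegative, multiplying the right side by
      \<open>?C \<ge> 1\<close> preserves the inequality.\<close>
    have "ln (1 / \<delta>) \<le> ln (log1 (B\<^sub>h / \<gamma>) / \<delta>)"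
      using assms by (intro ln_mono divide_right_mono) auto
    moreover have "0 \<le> ln (1 / \<delta>)" using assms by simp
    ultimately have "ln (1 / \<delta>) \<le> ?C * ln (log1 (B\<^sub>h / \<gamma>) / \<delta>)"
      using mult_mono[OF C, of "ln (1 / \<delta>)" "ln (log1 (B\<^sub>h / \<gamma>) / \<delta>)"] by simp
    with 1 have "(ln (card F) + ln (1 / \<delta>)) / n \<le>
        (?C * ?R * (d * ?l) + ?C * ln (log1 (B\<^sub>h / \<gamma>) / \<delta>)) / n"
      by (intro divide_right_mono) auto
    also have "\<dots> = ?C * (B\<^sub>Q\<^sup>2 * K\<^sup>2 * L\<^sub>h\<^sup>2 *
        (real d * (log1 d)\<^sup>2 * (log1 n) ^ 3 / (\<gamma>\<^sup>2 * real n)) + ln (log1 (B\<^sub>h / \<gamma>) / \<delta>) / real n)"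
      by (simp add: add_divide_distrib distrib_left mult_ac)
    finally show ?thesis .
  qed
  show ?thesis
  proof (intro bexI[OF _ E(1)] conjI E(2) ballI impI)
    fix \<omega> W assume \<omega>: "\<omega> \<in> E" and W: "W \<in> sos_class d m B\<^sub>Q"
      and feas: "\<forall>i<n. \<forall>t\<in>T. cert_value p h \<phi> \<phi>' W (\<omega> i) t \<le> - \<gamma>"
    obtain Q where "Q \<in> \<Q>" "W = V Q" using W by (auto simp: sos_class_eq)
    then have "err p h \<phi> \<phi>' T D W \<le> (ln (card F) + ln (1 / \<delta>)) / n"
      unfolding err_def using E(3)[OF \<omega>] feas by blast
    also note bound
    finally show "err p h \<phi> \<phi>' T D W \<le> ?C * (B\<^sub>Q\<^sup>2 * (B\<^sub>m\<^sup>2 + B\<^sub>D\<^sub>m * B\<^sub>m)\<^sup>2 * L\<^sub>h\<^sup>2 *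
      (real d * (log1 d)\<^sup>2 * (log1 n) ^ 3 / (\<gamma>\<^sup>2 * real n)) + ln (log1 (B\<^sub>h / \<gamma>) / \<delta>) / real n)"
      by (simp add: K_def)
  qed
qed

theorem theorem4p3:
  shows "\<exists>C::real. C > 0 \<and>
    (\<forall>(p::nat) (d::nat) (n::nat) (f :: rvec \<Rightarrow> rvec)
       (h :: rvec \<Rightarrow> rvec \<Rightarrow> real \<Rightarrow> rvec \<Rightarrow> real)
       (X :: rvec set) (S :: rvec set) (T :: real set)
       (\<phi> :: real \<Rightarrow> rvec \<Rightarrow> rvec) (\<phi>' :: real \<Rightarrow> rvec \<Rightarrow> rvec)
       (D :: rvec measure) (m :: rvec \<Rightarrow> rvec)
       (B\<^sub>Q::real) (B\<^sub>V::real) (B\<^sub>D\<^sub>V::real) (B\<^sub>h::real) (L\<^sub>h::real) (\<gamma>::real) (\<delta>::real).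
      continuous_map (Euclidean_space p) (Euclidean_space p) f \<longrightarrow>
      continuous_map
        (prod_topology (Euclidean_space p) (prod_topology (Euclidean_space p)
          (prod_topology euclideanreal (Euclidean_space p))))
        euclideanreal (\<lambda>(x, y, v, w). h x y v w) \<longrightarrow>
      compactin (Euclidean_space p) X \<longrightarrow>
      maximal_solution_interval p f X T \<longrightarrow>
      (\<forall>\<xi>\<in>X. ode_solution p f \<xi> T (\<lambda>t. \<phi> t \<xi>) (\<lambda>t. \<phi>' t \<xi>)) \<longrightarrow>
      prob_space D \<longrightarrow>
      sets D = sets (restrict_space borel X) \<longrightarrow>
      compactin (Euclidean_space p) S \<longrightarrow>
      (\<forall>\<xi>\<in>X. \<forall>t\<in>T. \<phi> t \<xi> \<in> S) \<longrightarrow>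
      monomial_map p d m \<longrightarrow>
      B\<^sub>Q > 0 \<longrightarrow>
      (\<forall>V\<in>sos_class d m B\<^sub>Q. \<forall>x\<in>S. \<bar>V x\<bar> \<le> B\<^sub>V) \<longrightarrow>
      (\<forall>V\<in>sos_class d m B\<^sub>Q. \<forall>x\<in>S. vnorm p (grad p V x) \<le> B\<^sub>D\<^sub>V) \<longrightarrow>
      (\<forall>x\<in>S. \<forall>v. \<forall>w\<in>Rn p. \<bar>v\<bar> \<le> B\<^sub>V \<longrightarrow> vnorm p w \<le> B\<^sub>D\<^sub>V \<longrightarrow> \<bar>h x (f x) v w\<bar> \<le> B\<^sub>h) \<longrightarrow>
      L\<^sub>h \<ge> 0 \<longrightarrow>
      (\<forall>x\<in>S. \<forall>v v'. \<forall>w\<in>Rn p. \<forall>w'\<in>Rn p.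
         \<bar>v\<bar> \<le> B\<^sub>V \<longrightarrow> \<bar>v'\<bar> \<le> B\<^sub>V \<longrightarrow> vnorm p w \<le> B\<^sub>D\<^sub>V \<longrightarrow> vnorm p w' \<le> B\<^sub>D\<^sub>V \<longrightarrow>
         \<bar>h x (f x) v w - h x (f x) v' w'\<bar>
           \<le> L\<^sub>h * sqrt ((v - v')\<^sup>2 + (vnorm p (\<lambda>i. w i - w' i))\<^sup>2)) \<longrightarrow>
      \<gamma> > 0 \<longrightarrow> 0 < \<delta> \<longrightarrow> \<delta> < 1 \<longrightarrow> n \<ge> 1 \<longrightarrow>
      (let B\<^sub>m = (SUP x\<in>S. vnorm d (m x));
           B\<^sub>D\<^sub>m = (SUP x\<in>S. op_norm d p (jacobian_mat m x))
       in \<exists>E\<in>sets (\<Pi>\<^sub>M i\<in>{..<n}. D).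
            measure (\<Pi>\<^sub>M i\<in>{..<n}. D) E \<ge> 1 - \<delta> \<and>
            (\<forall>\<xi>\<in>E. \<forall>V\<in>sos_class d m B\<^sub>Q.
               (\<forall>i<n. \<forall>t\<in>T. cert_value p h \<phi> \<phi>' V (\<xi> i) t \<le> - \<gamma>) \<longrightarrow>
               err p h \<phi> \<phi>' T D V
                 \<le> C * (B\<^sub>Q\<^sup>2 * (B\<^sub>m\<^sup>2 + B\<^sub>D\<^sub>m * B\<^sub>m)\<^sup>2 * L\<^sub>h\<^sup>2 *
                          (real d * (log1 d)\<^sup>2 * (log1 n) ^ 3 / (\<gamma>\<^sup>2 * real n))
                        + ln (log1 (B\<^sub>h / \<gamma>) / \<delta>) / real n))))"
  apply (rule exI[of _ "512 * ln 196608"], intro conjI allI impI)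
  subgoal using one_le_ln_196608 by linarith
  subgoal unfolding Let_def by (rule sos_generalization_bound)
  done

end
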